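(* Let $\xi\sim\nu$ be a random vector in $\mathbb{R}^d$ for which there is a constant $C>0$ with $|\xi|\le C$. For $\eta>0$ consider the online PCA (stochastic gradient ascent) Markov chain on the sphere $\mathbb{S}^{d-1}$, $$w^{n}=\frac{w^{n-1}+\eta\,\xi(n)\xi(n)^Tw^{n-1}}{|w^{n-1}+\eta\,\xi(n)\xi(n)^Tw^{n-1}|},\qquad \xi(n)\sim\nu\ \text{i.i.d.},$$ and let $S$ act on functions on $\mathbb{S}^{d-1}$ by $$Su(w)=\mathbb{E}\,u\!\left(\frac{w+\eta\xi\xi^Tw}{|w+\eta\xi\xi^Tw|}\right).$$ For a test function $\varphi$ let $u^n(w)=\mathbb{E}_{w}\varphi(w^n)$, so $u^0=\varphi$ and $u^{n+1}=Su^n$. Let $T>0$. Then: (i) $S:L^\infty(\mathbb{S}^{d-1})\to L^\infty(\mathbb{S}^{d-1})$ is a contraction, i.e. $\|Su\|_{L^\infty}\le\|u\|_{L^\infty}$. (ii) For any $\varphi\in C^k(\mathbb{S}^{d-1})$ there exist $\eta_0>0$ and $C(k,\eta_0,T)$ such that $$\|u^n\|_{C^k(\mathbb{S}^{d-1})}\le C(k,\eta_0,T)\,\|\varphi\|_{C^k(\mathbb{S}^{d-1})}\qquad\text{for all }\eta\le\eta_0\text{ and all }n\text{ with }n\eta\le T.$$ (iii) There exists $S^*:L^1(\mathbb{S}^{d-1})\to L^1(\mathbb{S}^{d-1})$ such that $S$ is the dual of $S^*$. $S^*$ is a contraction on $L^1$, i.e. $\|S^*\rho\|_1\le\|\rho\|_1$.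 Further, for any $\rho\in L^1(\mathbb{S}^{d-1})$ with $\rho\ge 0$, we have $S^*\rho\ge 0$ and $\|S^*\rho\|_1=\|\rho\|_1$.
   Context: $L^p(\mathbb{S}^{d-1})$ is with respect to surface measure. $\mathbb{E}_w$ is expectation for the chain started at $w^0=w$. For $\psi\in C^1(\mathbb{S}^{d-1})$, extended to a neighbourhood of the sphere, $\nabla_S\psi(w)=(I-w\otimes w)\nabla\psi(w)\in\mathbb{R}^d$ for $w\in\mathbb{S}^{d-1}$ (independent of the extension). $C^k(\mathbb{S}^{d-1})$ is the space of functions $k$ times continuously differentiable on the sphere with respect to $\nabla_S$, with norm $\|\psi\|_{C^k(\mathbb{S}^{d-1})}=\sum_{|\alpha|\le k}\sup_{w\in\mathbb{S}^{d-1}}|\nabla_S^\alpha\psi(w)|$, where $\alpha=(\alpha_1,\dots,\alpha_m)$, $m\le k$, $\alpha_j\in\{1,\dots,d\}$, and $\nabla_S^\alpha$ is the product (composition) of the components $(\nabla_S)_{\alpha_1},\dots,(\nabla_S)_{\alpha_m}$. "$S$ is the dual of $S^*$" means $\int_{\mathbb{S}^{d-1}}(Su)\rho\,dS=\int_{\mathbb{S}^{d-1}}u\,(S^*\rho)\,dS$ for all $u\in L^\infty$, $\rho\in L^1$. The constant in (ii) does not depend on $n$ or $\eta$; it may depend on the fixed data $d$ and $\nu$. *)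

theory Defs
  imports "HOL-Probability.Probability"
begin

section \<open>The sphere: surface measure and Lebesgue spaces\<close>

text \<open>
  The surface measure of a Borel set \<open>A\<close> of the unit sphere is \<open>d\<close> times the volume of the cone
  \<open>{x. 0 < |x| \<le> 1 \<and> x / |x| \<in> A}\<close>. For \<open>d = 1\<close> this is the counting measure on \<open>{-1, 1}\<close>.
\<close>

definition sphere_measure :: "(real ^ 'd) measure" where
  "sphere_measure =
     scale_measure (of_nat CARD('d))
       (distr (restrict_space lborel (cball 0 1 - {0})) (restrict_space borel (sphere 0 1))
          (\<lambda>x. x /\<^sub>R norm x))"

lemma emeasure_sphere_measure:
  fixes A :: "(real ^ 'd) set"
  assumes A: "A \<in> sets borel" "A \<subseteq> sphere 0 1"
  shows "emeasure sphere_measure A =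
    of_nat CARD('d) * emeasure lborel {x. 0 < norm x \<and> norm x \<le> 1 \<and> x /\<^sub>R norm x \<in> A}"
proof -
  let ?R = "restrict_space lborel (cball 0 1 - {0}) :: (real ^ 'd) measure"
  let ?T = "restrict_space borel (sphere 0 1) :: (real ^ 'd) measure"
  let ?f = "\<lambda>x :: real ^ 'd. x /\<^sub>R norm x"
  have "?f \<in> borel_measurable borel" by measurable
  then have f: "?f \<in> measurable ?R ?T"
    by (intro measurable_restrict_space2 measurable_restrict_space1)
       (auto simp: space_restrict_space)
  have AT: "A \<in> sets ?T" using A by (auto simp: sets_restrict_space)
  have "emeasure (distr ?R ?T ?f) A = emeasure ?R (?f -` A \<inter> space ?R)"
    by (rule emeasure_distr[OF f AT])
  also have "\<dots> = emeasure lborel (?f -` A \<inter> space ?R)"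
    by (rule emeasure_restrict_space) (auto simp: space_restrict_space)
  also have "?f -` A \<inter> space ?R = {x. 0 < norm x \<and> norm x \<le> 1 \<and> x /\<^sub>R norm x \<in> A}"
    by (auto simp: space_restrict_space)
  finally show ?thesis by (simp add: sphere_measure_def)
qed

text \<open>
  Elements of \<open>L\<^sup>1\<close> and \<open>L\<^sup>\<infinity>\<close> are represented by Borel functions; a map on such functions
  induces a map of the spaces of classes iff it respects almost-everywhere equality.
\<close>

definition Linf :: "(real ^ 'd \<Rightarrow> real) set" where
  "Linf = {u \<in> borel_measurable sphere_measure. esssup sphere_measure (\<lambda>w. ereal \<bar>u w\<bar>) < \<infinity>}"

definition Linf_norm :: "(real ^ 'd \<Rightarrow> real) \<Rightarrow> ereal" where
  "Linf_norm u = esssup sphere_measure (\<lambda>w. ereal \<bar>u w\<bar>)"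

definition L1 :: "(real ^ 'd \<Rightarrow> real) set" where
  "L1 = {\<rho>. integrable sphere_measure \<rho>}"

definition L1_norm :: "(real ^ 'd \<Rightarrow> real) \<Rightarrow> real" where
  "L1_norm \<rho> = (LINT w|sphere_measure. \<bar>\<rho> w\<bar>)"

definition maps_classes ::
    "((real ^ 'd \<Rightarrow> real) \<Rightarrow> (real ^ 'd \<Rightarrow> real)) \<Rightarrow> (real ^ 'd \<Rightarrow> real) set \<Rightarrow> bool" where
  "maps_classes F X \<longleftrightarrow>
     (\<forall>u\<in>X. F u \<in> X) \<and>
     (\<forall>u\<in>X. \<forall>v\<in>X. (AE w in sphere_measure. u w = v w) \<longrightarrow>
                    (AE w in sphere_measure. F u w = F v w))"


section \<open>Differentiation on the sphere\<close>

definition C1_extension ::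
    "(real ^ 'd \<Rightarrow> real) \<Rightarrow> (real ^ 'd \<Rightarrow> real) \<Rightarrow> (real ^ 'd \<Rightarrow> real ^ 'd) \<Rightarrow> bool" where
  "C1_extension \<psi> \<Psi> g \<longleftrightarrow>
     (\<forall>w\<in>sphere 0 1. \<Psi> w = \<psi> w) \<and>
     (\<exists>U. open U \<and> sphere 0 1 \<subseteq> U \<and> (\<forall>x\<in>U. GDERIV \<Psi> x :> g x) \<and> continuous_on U g)"

definition tangential :: "real ^ 'd \<Rightarrow> real ^ 'd \<Rightarrow> real ^ 'd" where
  "tangential w v = v - (w \<bullet> v) *\<^sub>R w"

definition grad_S :: "(real ^ 'd \<Rightarrow> real) \<Rightarrow> real ^ 'd \<Rightarrow> real ^ 'd" where
  "grad_S \<psi> w = (THE v. \<exists>\<Psi> g. C1_extension \<psi> \<Psi> g \<and> v = tangential w (g w))"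

lemma tangential_unique:
  fixes w :: "real ^ 'd"
  assumes "C1_extension \<psi> \<Psi>1 g1" "C1_extension \<psi> \<Psi>2 g2" and w: "w \<in> sphere 0 1"
  shows "tangential w (g1 w) = tangential w (g2 w)"
proof -
  have D: "GDERIV \<Psi>1 w :> g1 w" "GDERIV \<Psi>2 w :> g2 w"
    using assms unfolding C1_extension_def by blast+
  have eq: "\<Psi>1 x = \<Psi>2 x" if "x \<in> sphere 0 1" for x
    using assms that unfolding C1_extension_def by metis
  define h where "h = tangential w (g1 w - g2 w)"
  have ww: "w \<bullet> w = 1" using w by (simp add: dot_square_norm)
  have wh: "w \<bullet> h = 0" by (simp add: h_def tangential_def inner_diff_right ww)
  define c where "c t = (w + t *\<^sub>R h) /\<^sub>R norm (w + t *\<^sub>R h)" for t :: real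
  have n2: "(w + t *\<^sub>R h) \<bullet> (w + t *\<^sub>R h) = 1 + t\<^sup>2 * (h \<bullet> h)" for t
    using wh ww by (simp add: inner_add_left inner_add_right inner_commute[of h w] power2_eq_square)
  have nz: "w + t *\<^sub>R h \<noteq> 0" for t
  proof
    assume "w + t *\<^sub>R h = 0"
    then have "1 + t\<^sup>2 * (h \<bullet> h) = 0" using n2[of t] by simp
    moreover have "t\<^sup>2 * (h \<bullet> h) \<ge> 0" by simp
    ultimately show False by linarith
  qed
  have cs: "c t \<in> sphere 0 1" for t using nz[of t] by (simp add: c_def)
  have cv: "c t = (1 / sqrt (1 + t\<^sup>2 * (h \<bullet> h))) *\<^sub>R (w + t *\<^sub>R h)" for t
    unfolding c_def norm_eq_sqrt_inner n2 by (simp add: divide_inverse)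
  have c0: "c 0 = w" by (simp add: cv)
  have dr: "((\<lambda>t. 1 / sqrt (1 + t\<^sup>2 * (h \<bullet> h))) has_real_derivative 0) (at 0)"
    by (auto intro!: derivative_eq_intros)
  have "((\<lambda>t. (1 / sqrt (1 + t\<^sup>2 * (h \<bullet> h))) *\<^sub>R (w + t *\<^sub>R h)) has_derivative (\<lambda>s. s *\<^sub>R h)) (at 0)"
    by (rule derivative_eq_intros dr[unfolded has_field_derivative_def] | simp)+
  then have dc: "(c has_derivative (\<lambda>s. s *\<^sub>R h)) (at 0)"
    using cv by presburger
  have "((\<lambda>t. \<Psi>1 (c t)) has_derivative (\<lambda>s. (s *\<^sub>R h) \<bullet> g1 w)) (at 0)"
    using has_derivative_compose[OF dc, of \<Psi>1 "\<lambda>x. x \<bullet> g1 w"] D(1) unfolding gderiv_def c0 by simp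
  moreover have "((\<lambda>t. \<Psi>2 (c t)) has_derivative (\<lambda>s. (s *\<^sub>R h) \<bullet> g2 w)) (at 0)"
    using has_derivative_compose[OF dc, of \<Psi>2 "\<lambda>x. x \<bullet> g2 w"] D(2) unfolding gderiv_def c0 by simp
  moreover have "(\<lambda>t. \<Psi>1 (c t)) = (\<lambda>t. \<Psi>2 (c t))" using eq cs by auto
  ultimately have "(\<lambda>s. (s *\<^sub>R h) \<bullet> g1 w) = (\<lambda>s. (s *\<^sub>R h) \<bullet> g2 w)"
    using has_derivative_unique by metis
  from fun_cong[OF this, of 1] have "h \<bullet> (g1 w - g2 w) = 0" by (simp add: inner_diff_right)
  moreover have "h \<bullet> h = h \<bullet> (g1 w - g2 w)"
    using wh by (subst (2) h_def)
      (simp add: tangential_def inner_diff_right inner_diff_left inner_commute)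
  ultimately have "h = 0" by simp
  then show ?thesis
    by (simp add: h_def tangential_def inner_diff_right algebra_simps)
qed

lemma grad_S_eq:
  assumes "C1_extension \<psi> \<Psi> g" "w \<in> sphere 0 1"
  shows "grad_S \<psi> w = tangential w (g w)"
  unfolding grad_S_def using assms tangential_unique by (intro the_equality) blast+

text \<open>The values of \<open>\<psi>\<close> off the sphere play no role here.\<close>

primrec Ck_sphere :: "nat \<Rightarrow> (real ^ 'd \<Rightarrow> real) \<Rightarrow> bool" where
  "Ck_sphere 0 \<psi> \<longleftrightarrow> continuous_on (sphere 0 1) \<psi>"
| "Ck_sphere (Suc k) \<psi> \<longleftrightarrow>
     (\<exists>\<Psi> g. C1_extension \<psi> \<Psi> g) \<and> (\<forall>i. Ck_sphere k (\<lambda>w. grad_S \<psi> w $ i))"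

primrec grad_S_multi :: "'d list \<Rightarrow> (real ^ 'd \<Rightarrow> real) \<Rightarrow> (real ^ 'd \<Rightarrow> real)" where
  "grad_S_multi [] \<psi> = \<psi>"
| "grad_S_multi (i # \<alpha>) \<psi> = (\<lambda>w. grad_S (grad_S_multi \<alpha> \<psi>) w $ i)"

definition Ck_norm :: "nat \<Rightarrow> (real ^ 'd \<Rightarrow> real) \<Rightarrow> real" where
  "Ck_norm k \<psi> = (\<Sum>\<alpha> | length \<alpha> \<le> k. SUP w\<in>sphere 0 1. \<bar>grad_S_multi \<alpha> \<psi> w\<bar>)"


section \<open>The online PCA chain\<close>

text \<open>Note \<open>\<xi> \<xi>\<^sup>T w = (\<xi> \<bullet> w) \<xi>\<close>.\<close>

definition pca_step :: "real \<Rightarrow> real ^ 'd \<Rightarrow> real ^ 'd \<Rightarrow> real ^ 'd" where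
  "pca_step \<eta> \<xi> w =
     (w + \<eta> *\<^sub>R ((\<xi> \<bullet> w) *\<^sub>R \<xi>)) /\<^sub>R norm (w + \<eta> *\<^sub>R ((\<xi> \<bullet> w) *\<^sub>R \<xi>))"

definition pca_S :: "(real ^ 'd) measure \<Rightarrow> real \<Rightarrow> (real ^ 'd \<Rightarrow> real) \<Rightarrow> (real ^ 'd \<Rightarrow> real)" where
  "pca_S \<nu> \<eta> u w = (LINT \<xi>|\<nu>. u (pca_step \<eta> \<xi> w))"

text \<open>The sample \<open>\<xi>(n + 1)\<close> is the coordinate \<open>\<omega> n\<close> of a sequence \<open>\<omega>\<close>.\<close>

primrec pca_chain :: "real \<Rightarrow> (nat \<Rightarrow> real ^ 'd) \<Rightarrow> real ^ 'd \<Rightarrow> nat \<Rightarrow> real ^ 'd" where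
  "pca_chain \<eta> \<omega> w 0 = w"
| "pca_chain \<eta> \<omega> w (Suc n) = pca_step \<eta> (\<omega> n) (pca_chain \<eta> \<omega> w n)"

text \<open>\<open>u\<^sup>n(w) = E\<^sub>w \<phi>(w\<^sup>n)\<close>, with the i.i.d. samples realised on the infinite product space.\<close>

definition pca_u ::
    "(real ^ 'd) measure \<Rightarrow> real \<Rightarrow> (real ^ 'd \<Rightarrow> real) \<Rightarrow> nat \<Rightarrow> (real ^ 'd \<Rightarrow> real)" where
  "pca_u \<nu> \<eta> \<phi> n w = (LINT \<omega>|(\<Pi>\<^sub>M i\<in>UNIV. \<nu>). \<phi> (pca_chain \<eta> \<omega> w n))"

lemma pca_step_sphere:
  assumes "\<eta> \<ge> 0" "w \<in> sphere 0 1"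
  shows "pca_step \<eta> \<xi> w \<in> sphere 0 1"
proof -
  have "w \<bullet> (w + \<eta> *\<^sub>R ((\<xi> \<bullet> w) *\<^sub>R \<xi>)) = 1 + \<eta> * (\<xi> \<bullet> w)\<^sup>2"
    using assms(2) by (simp add: inner_add_right dot_square_norm power2_eq_square inner_commute)
  moreover have "\<dots> > 0" using assms(1) by (simp add: add_pos_nonneg)
  ultimately have "w + \<eta> *\<^sub>R ((\<xi> \<bullet> w) *\<^sub>R \<xi>) \<noteq> 0" by force
  then show ?thesis by (simp add: pca_step_def)
qed

lemma pca_chain_sphere:
  "\<eta> \<ge> 0 \<Longrightarrow> w \<in> sphere 0 1 \<Longrightarrow> pca_chain \<eta> \<omega> w n \<in> sphere 0 1"
  by (induction n) (simp_all only: pca_chain.simps pca_step_sphere)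

lemma pca_chain_case_nat:
  "pca_chain \<eta> (case_nat \<xi> \<omega>) w (Suc n) = pca_chain \<eta> \<omega> (pca_step \<eta> \<xi> w) n"
  by (induction n) auto

lemma pca_u_0: "prob_space \<nu> \<Longrightarrow> pca_u \<nu> \<eta> \<phi> 0 w = \<phi> w"
  by (simp add: pca_u_def prob_space.prob_space prob_space_PiM)

lemma pca_u_Suc:
  fixes \<nu> :: "(real ^ 'd) measure"
  assumes "prob_space \<nu>" and nu: "sets \<nu> = sets borel" and "\<eta> > 0"
    and phi: "\<phi> \<in> borel_measurable (restrict_space borel (sphere 0 1))"
    and bound: "\<And>w. w \<in> sphere 0 1 \<Longrightarrow> \<bar>\<phi> w\<bar> \<le> K"
    and w: "w \<in> sphere 0 1"
  shows "pca_u \<nu> \<eta> \<phi> (Suc n) w = pca_S \<nu> \<eta> (pca_u \<nu> \<eta> \<phi> n) w"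
proof -
  interpret sequence_space \<nu>
    by (simp add: sequence_space_def product_prob_space_def product_sigma_finite_def
        product_prob_space_axioms_def assms prob_space_imp_sigma_finite)
  let ?P = "(\<Pi>\<^sub>M i\<in>UNIV. \<nu>) :: (nat \<Rightarrow> real ^ 'd) measure"
  note nu[measurable_cong]
  have step: "case_prod (pca_step \<eta>) \<in> borel_measurable (borel \<Otimes>\<^sub>M borel)"
    unfolding pca_step_def by measurable
  have chain: "(\<lambda>\<omega>. pca_chain \<eta> \<omega> w m) \<in> borel_measurable ?P" for m
  proof (induction m)
    case (Suc m)
    note Suc[measurable] step[measurable]
    show ?case by simp
  qed simp
  have phi_chain: "(\<lambda>\<omega>. \<phi> (pca_chain \<eta> \<omega> w m)) \<in> borel_measurable ?P" for m
    by (rule measurable_compose[OF measurable_restrict_space2[OF _ chain] phi])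
       (use pca_chain_sphere[OF less_imp_le[OF \<open>\<eta> > 0\<close>] w] in blast)
  have cn: "(\<lambda>(s, \<omega>). case_nat s \<omega>) \<in> measurable (\<nu> \<Otimes>\<^sub>M ?P) ?P"
    by measurable
  interpret pair_sigma_finite \<nu> ?P
    by (simp add: P.sigma_finite_measure_axioms pair_sigma_finite_def prob_space_imp_sigma_finite assms)
  interpret PP: prob_space "\<nu> \<Otimes>\<^sub>M ?P"
    by (intro prob_space_pair assms P.prob_space_axioms)
  have int: "integrable (\<nu> \<Otimes>\<^sub>M ?P) (\<lambda>(s, \<omega>). \<phi> (pca_chain \<eta> (case_nat s \<omega>) w (Suc n)))"
    using measurable_compose[OF cn phi_chain[of "Suc n"]] pca_chain_sphere w \<open>\<eta> > 0\<close>
    by (intro PP.integrable_const_bound[where B=K])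
       (auto simp: case_prod_beta simp del: mem_sphere_0 pca_chain.simps
          intro!: bound pca_chain_sphere)
  have "pca_u \<nu> \<eta> \<phi> (Suc n) w =
      (LINT \<omega>|(distr (\<nu> \<Otimes>\<^sub>M ?P) ?P (\<lambda>(s, \<omega>). case_nat s \<omega>)). \<phi> (pca_chain \<eta> \<omega> w (Suc n)))"
    unfolding pca_u_def PiM_iter ..
  also have "\<dots> = (LINT p|(\<nu> \<Otimes>\<^sub>M ?P). \<phi> (pca_chain \<eta> (case p of (s, \<omega>) \<Rightarrow> case_nat s \<omega>) w (Suc n)))"
    by (rule integral_distr[OF cn phi_chain])
  also have "\<dots> = (LINT s|\<nu>. LINT \<omega>|?P. \<phi> (pca_chain \<eta> (case_nat s \<omega>) w (Suc n)))"
    using integral_fst'[OF int] by (simp add: case_prod_beta' del: pca_chain.simps)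
  finally show ?thesis
    unfolding pca_S_def pca_u_def pca_chain_case_nat .
qed

end

theory Submission
  imports Defs
begin

text \<open>
  For a fixed sample \<open>\<xi>\<close> the chain moves by \<open>\<tau> w = A w / |A w|\<close> with
  \<open>A = I + \<eta> \<xi> \<xi>\<^sup>T\<close>. This matrix is symmetric, invertible, \<open>\<eta>\<close>-close to the identity, and does
  not shorten vectors. All three parts follow from these properties of a single step, averaged
  over \<open>\<xi>\<close>.

  Parts (i) and (iii): since \<open>A\<close> is linear and injective, the preimage under \<open>\<tau>\<close> of a null set is null
  (\<open>null_sets_pca_step_vimage\<close>). Hence an almost sure property of the point
  \<open>w\<close> holds for almost every \<open>w\<close> and almost every \<open>\<xi>\<close> at the point \<open>\<tau> w\<close> (\<open>AE_step\<close>), and averaging over \<open>\<xi>\<close> gives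
  the statements about \<open>S\<close> on \<open>L\<^sup>\<infinity>\<close>. For \<open>\<rho> \<ge> 0\<close> the law of \<open>\<tau> w\<close>, with \<open>w\<close> distributed
  according to \<open>\<rho> dS\<close>, is then absolutely continuous, and \<open>S\<^sup>*\<rho>\<close> is its Radon--Nikodym density;
  a signed \<open>\<rho>\<close> is split into its positive and negative parts.

  Part (ii): extend \<open>u\<close> to \<open>x \<mapsto> u (x / |x|)\<close>. The ordinary gradient of this extension on the sphere
  is \<open>\<nabla>\<^sub>S u\<close>, and the extension of \<open>u \<circ> \<tau>\<close> is that of \<open>u\<close> composed with the linear map \<open>A\<close>. Therefore
  \<open>\<nabla>\<^sub>S (u \<circ> \<tau>) = r A ((\<nabla>\<^sub>S u) \<circ> \<tau>)\<close> with \<open>r = 1 / |A w| \<le> 1\<close>: a component of the gradient is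
  \<open>r\<close> times the same component of \<open>\<nabla>\<^sub>S u\<close> at \<open>\<tau> w\<close> plus terms with a factor \<open>\<eta>\<close>. The gradient
  of \<open>r\<close> carries a factor \<open>\<eta>\<close> as well, so that iterating yields
  \<open>\<nabla>\<^sub>S\<^sup>\<alpha> (u \<circ> \<tau>) = r\<^bsup>|\<alpha>|\<^esup> (\<nabla>\<^sub>S\<^sup>\<alpha> u) \<circ> \<tau> + \<eta> E\<close>
  (\<open>grad_S_multi_pca_step\<close>), where \<open>E\<close> combines derivatives of \<open>u\<close> at \<open>\<tau> w\<close> of order at most \<open>|\<alpha>|\<close>. Its
  coefficients are polynomials in \<open>\<eta>\<close>, \<open>\<xi>\<close>, \<open>w\<close> and \<open>r\<close>, hence bounded for \<open>\<eta> \<le> 1\<close> and bounded \<open>\<xi>\<close>.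
  Since \<open>r \<le> 1\<close>, taking expectations gives
  \<open>\<parallel>S u\<parallel> \<le> (1 + K \<eta>) \<parallel>u\<parallel>\<close> in \<open>C\<^sup>k\<close> (\<open>Ck_norm_pca_S_le\<close>), and \<open>n \<le> T / \<eta>\<close> steps cost at most the factor
  \<open>exp (K T)\<close>.
\<close>

section \<open>Gradients on the sphere through the radial extension\<close>

text \<open>
  The function \<open>x \<mapsto> u (sgn x)\<close> is the extension of \<open>u\<close> that is constant along rays. It makes the
  gradient on the sphere an ordinary one, so the usual calculus applies without
  choosing extensions and without tangent projections.
\<close>

definition has_sphere_grad :: "(real ^ 'd \<Rightarrow> real) \<Rightarrow> (real ^ 'd \<Rightarrow> real ^ 'd) \<Rightarrow> bool" where
  "has_sphere_grad u G \<longleftrightarrow> (\<forall>w\<in>sphere 0 1. GDERIV (\<lambda>x. u (sgn x)) w :> G w)"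

lemma sgn_sphere: "w \<in> sphere 0 1 \<Longrightarrow> sgn w = w" for w :: "real ^ 'd"
  by (simp add: sgn_div_norm)

lemma sgn_in_sphere: "x \<noteq> 0 \<Longrightarrow> sgn x \<in> sphere 0 1" for x :: "real ^ 'd"
  by (simp add: norm_sgn)

lemma GDERIV_transform_nonzero:
  fixes w :: "real ^ 'd"
  assumes "GDERIV f w :> D" "w \<noteq> 0" "\<And>x. x \<noteq> 0 \<Longrightarrow> f x = g x"
  shows "GDERIV g w :> D"
  using assms unfolding gderiv_def
  by (auto intro: has_derivative_transform_within_open[where s="- {0}" and t=UNIV])

lemma has_sphere_grad_transform:
  fixes u v :: "real ^ 'd \<Rightarrow> real"
  assumes u: "has_sphere_grad u G"
    and uv: "\<And>w. w \<in> sphere 0 1 \<Longrightarrow> u w = v w"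
    and GH: "\<And>w. w \<in> sphere 0 1 \<Longrightarrow> G w = H w"
  shows "has_sphere_grad v H"
  unfolding has_sphere_grad_def
proof
  fix w :: "real ^ 'd" assume w: "w \<in> sphere 0 1"
  have "GDERIV (\<lambda>x. u (sgn x)) w :> G w" using u w unfolding has_sphere_grad_def by blast
  then have "GDERIV (\<lambda>x. v (sgn x)) w :> G w"
    by (rule GDERIV_transform_nonzero) (use w uv[OF sgn_in_sphere] in auto)
  then show "GDERIV (\<lambda>x. v (sgn x)) w :> H w" using GH[OF w] by simp
qed

text \<open>
  The extension is invariant under scaling, so its differentiability on the sphere propagates to all
  \<open>x \<noteq> 0\<close>; the gradient is homogeneous of degree \<open>-1\<close>.
\<close>

lemma has_sphere_grad_GDERIV:
  fixes u :: "real ^ 'd \<Rightarrow> real"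
  assumes "has_sphere_grad u G" and x: "x \<noteq> 0"
  shows "GDERIV (\<lambda>x. u (sgn x)) x :> G (sgn x) /\<^sub>R norm x"
proof -
  let ?c = "inverse (norm x)"
  have c: "?c > 0" using x by simp
  have "((\<lambda>y. ?c *\<^sub>R y) has_derivative (\<lambda>h. ?c *\<^sub>R h)) (at x)"
    by (auto intro!: derivative_eq_intros)
  moreover have "((\<lambda>y. u (sgn y)) has_derivative (\<lambda>h. h \<bullet> G (sgn x))) (at (?c *\<^sub>R x))"
    using assms(1) sgn_in_sphere[OF x] unfolding has_sphere_grad_def gderiv_def sgn_div_norm by blast
  ultimately have "((\<lambda>y. u (sgn (?c *\<^sub>R y))) has_derivative (\<lambda>h. (?c *\<^sub>R h) \<bullet> G (sgn x))) (at x)"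
    by (rule has_derivative_compose)
  moreover have "(\<lambda>y. u (sgn (?c *\<^sub>R y))) = (\<lambda>y. u (sgn y))"
    using c by (simp add: sgn_scaleR)
  ultimately show ?thesis by (simp add: gderiv_def)
qed

text \<open>
  The extension is constant on the ray through \<open>w\<close>, so its radial derivative vanishes.
\<close>

lemma has_sphere_grad_tangent:
  fixes u :: "real ^ 'd \<Rightarrow> real"
  assumes "has_sphere_grad u G" and w: "w \<in> sphere 0 1"
  shows "w \<bullet> G w = 0"
proof -
  have "((\<lambda>t. t *\<^sub>R w) has_derivative (\<lambda>s. s *\<^sub>R w)) (at (1::real))"
    by (auto intro!: derivative_eq_intros)
  moreover have "((\<lambda>y. u (sgn y)) has_derivative (\<lambda>h. h \<bullet> G w)) (at ((1::real) *\<^sub>R w))"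
    using assms unfolding has_sphere_grad_def gderiv_def by simp
  ultimately have "((\<lambda>t. u (sgn (t *\<^sub>R w))) has_derivative (\<lambda>s. (s *\<^sub>R w) \<bullet> G w)) (at (1::real))"
    by (rule has_derivative_compose)
  then have "((\<lambda>t. u w) has_derivative (\<lambda>s. (s *\<^sub>R w) \<bullet> G w)) (at (1::real))"
    by (rule has_derivative_transform_within_open[where s="{0<..}"])
       (use w in \<open>auto simp: sgn_scaleR sgn_div_norm\<close>)
  then have "(\<lambda>s. (s *\<^sub>R w) \<bullet> G w) = (\<lambda>s. 0)"
    using has_derivative_unique has_derivative_const by blast
  from fun_cong[OF this, of 1] show ?thesis by simp
qed

lemma has_derivative_sgn_sphere:
  fixes w :: "real ^ 'd"
  assumes w: "w \<in> sphere 0 1"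
  shows "(sgn has_derivative (\<lambda>h. h - (w \<bullet> h) *\<^sub>R w)) (at w)"
proof -
  have wn: "w \<noteq> 0" "norm w = 1" "sgn w = w" using w sgn_sphere by auto
  have "GDERIV (\<lambda>x. inverse (norm x)) w :> - (inverse (norm w))\<^sup>2 *\<^sub>R sgn w"
    by (rule GDERIV_inverse[OF GDERIV_norm]) (use wn in auto)
  then have "((\<lambda>x. inverse (norm x)) has_derivative (\<lambda>h. - (h \<bullet> w))) (at w)"
    unfolding gderiv_def using wn by simp
  then have "((\<lambda>x. inverse (norm x) *\<^sub>R x) has_derivative
      (\<lambda>h. inverse (norm w) *\<^sub>R h + (- (h \<bullet> w)) *\<^sub>R w)) (at w)"
    by (rule has_derivative_scaleR[OF _ has_derivative_ident])
  then show ?thesis unfolding sgn_div_norm[abs_def] using wn by (simp add: inner_commute)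
qed

text \<open>
  The derivative of \<open>x \<mapsto> x / |x|\<close> at a point of the sphere is the projection to the tangent space.
\<close>

lemma has_sphere_grad_of_GDERIV:
  fixes f :: "real ^ 'd \<Rightarrow> real"
  assumes "\<And>w. w \<in> sphere 0 1 \<Longrightarrow> GDERIV f w :> D w"
  shows "has_sphere_grad f (\<lambda>w. tangential w (D w))"
  unfolding has_sphere_grad_def
proof
  fix w :: "real ^ 'd" assume w: "w \<in> sphere 0 1"
  have "(f has_derivative (\<lambda>h. h \<bullet> D w)) (at (sgn w))"
    using assms[OF w] sgn_sphere[OF w] by (simp add: gderiv_def)
  from has_derivative_compose[OF has_derivative_sgn_sphere[OF w] this]
  show "GDERIV (\<lambda>x. f (sgn x)) w :> tangential w (D w)"
    unfolding gderiv_def tangential_def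
    by (simp add: inner_diff_right inner_diff_left inner_commute mult.commute)
qed

lemma has_sphere_grad_of_extension:
  assumes "C1_extension u \<Psi> g"
  shows "has_sphere_grad u (\<lambda>w. tangential w (g w))"
proof -
  have "has_sphere_grad \<Psi> (\<lambda>w. tangential w (g w))"
    using assms unfolding C1_extension_def by (intro has_sphere_grad_of_GDERIV) blast
  moreover have "\<Psi> w = u w" if "w \<in> sphere 0 1" for w
    using assms that unfolding C1_extension_def by blast
  ultimately show ?thesis by (rule has_sphere_grad_transform[OF _ _ refl])
qed

text \<open>
  With its converse \<open>C1_extension_grad_S\<close> this shows that the radial extension decides whether some
  continuously differentiable extension exists.
\<close>

lemma C1_extension_of_sphere_grad:
  fixes u :: "real ^ 'd \<Rightarrow> real"
  assumes u: "has_sphere_grad u G" and G: "continuous_on (sphere 0 1) G"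
  shows "C1_extension u (\<lambda>x. u (sgn x)) (\<lambda>x. G (sgn x) /\<^sub>R norm x)"
  unfolding C1_extension_def
proof (intro conjI ballI exI[of _ "- {0}"])
  show "GDERIV (\<lambda>x. u (sgn x)) x :> G (sgn x) /\<^sub>R norm x" if "x \<in> - {0}" for x
    using that has_sphere_grad_GDERIV[OF u] by simp
  have "continuous_on (- {0}) (\<lambda>x :: real ^ 'd. G (sgn x))"
    by (rule continuous_on_compose2[OF G])
       (auto intro!: continuous_intros simp: norm_sgn split: if_splits)
  then show "continuous_on (- {0}) (\<lambda>x. G (sgn x) /\<^sub>R norm x)"
    by (intro continuous_intros) auto
qed (auto simp: sgn_div_norm)

lemma grad_S_eqI:
  assumes "has_sphere_grad u G" "continuous_on (sphere 0 1) G" "w \<in> sphere 0 1"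
  shows "grad_S u w = G w"
proof -
  have "grad_S u w = tangential w (G (sgn w) /\<^sub>R norm w)"
    using grad_S_eq[OF C1_extension_of_sphere_grad[OF assms(1,2)] assms(3)] .
  also have "\<dots> = G w"
    using assms(3) has_sphere_grad_tangent[OF assms(1,3)]
    by (simp add: tangential_def sgn_div_norm)
  finally show ?thesis .
qed

lemma C1_extension_grad_S:
  assumes "C1_extension u \<Psi> g"
  shows "has_sphere_grad u (grad_S u)" "continuous_on (sphere 0 1) (grad_S u)"
proof -
  have e: "grad_S u w = tangential w (g w)" if "w \<in> sphere 0 1" for w
    using grad_S_eq[OF assms that] .
  show "has_sphere_grad u (grad_S u)"
    by (rule has_sphere_grad_transform[OF has_sphere_grad_of_extension[OF assms]])
       (simp_all only: e)
  obtain U where "sphere 0 1 \<subseteq> U" "continuous_on U g"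
    using assms unfolding C1_extension_def by blast
  then have "continuous_on (sphere 0 1) g" using continuous_on_subset by blast
  then have "continuous_on (sphere 0 1) (\<lambda>w. tangential w (g w))"
    unfolding tangential_def by (intro continuous_intros)
  then show "continuous_on (sphere 0 1) (grad_S u)"
    by (simp only: e cong: continuous_on_cong)
qed

lemma grad_S_cong:
  assumes "\<And>w. w \<in> sphere 0 1 \<Longrightarrow> u w = v w"
  shows "grad_S u = grad_S v"
proof -
  have "C1_extension u \<Psi> g \<longleftrightarrow> C1_extension v \<Psi> g" for \<Psi> g
    unfolding C1_extension_def using assms by auto
  then show ?thesis by (simp only: grad_S_def[abs_def])
qed

lemma grad_S_multi_cong:
  assumes "\<And>w. w \<in> sphere 0 1 \<Longrightarrow> u w = v w" and "w \<in> sphere 0 1"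
  shows "grad_S_multi \<alpha> u w = grad_S_multi \<alpha> v w"
  using assms(2)
proof (induction \<alpha> arbitrary: w)
  case (Cons i \<alpha>)
  have "grad_S (grad_S_multi \<alpha> u) = grad_S (grad_S_multi \<alpha> v)"
    by (rule grad_S_cong) (rule Cons.IH)
  then show ?case by simp
qed (simp add: assms del: mem_sphere_0)

lemma grad_S_multi_append: "grad_S_multi (\<alpha> @ \<beta>) u = grad_S_multi \<alpha> (grad_S_multi \<beta> u)"
  by (induction \<alpha>) auto

text \<open>
  \<open>Ck_sphere\<close> strips derivatives from the inside (the first one taken comes first), whereas
  \<open>grad_S_multi\<close> adds them on the outside. The characterisation by all \<open>grad_S_multi\<close> removes this mismatch, and
  the later inductions on \<open>\<alpha>\<close> need only look at the outermost derivative.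
\<close>

lemma Ck_sphere_iff:
  fixes u :: "real ^ 'd \<Rightarrow> real"
  shows "Ck_sphere k u \<longleftrightarrow>
    (\<forall>\<alpha>. length \<alpha> < k \<longrightarrow> (\<exists>\<Psi> g. C1_extension (grad_S_multi \<alpha> u) \<Psi> g)) \<and>
    (\<forall>\<alpha>. length \<alpha> = k \<longrightarrow> continuous_on (sphere 0 1) (grad_S_multi \<alpha> u))"
proof (induction k arbitrary: u)
  case (Suc k)
  have snoc: "grad_S_multi (\<alpha> @ [i]) u = grad_S_multi \<alpha> (\<lambda>w. grad_S u w $ i)" for \<alpha> i
    by (simp add: grad_S_multi_append)
  show ?case (is "_ \<longleftrightarrow> ?E \<and> ?C")
  proof
    assume L: "Ck_sphere (Suc k) u"
    have "\<exists>\<Psi> g. C1_extension (grad_S_multi \<alpha> u) \<Psi> g" if "length \<alpha> < Suc k" for \<alpha>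
    proof (cases \<alpha> rule: rev_cases)
      case Nil then show ?thesis using L by simp
    next
      case (snoc \<beta> i)
      then show ?thesis using L Suc.IH[of "\<lambda>w. grad_S u w $ i"] that
        by (simp add: grad_S_multi_append)
    qed
    moreover have "continuous_on (sphere 0 1) (grad_S_multi \<alpha> u)" if "length \<alpha> = Suc k" for \<alpha>
    proof (cases \<alpha> rule: rev_cases)
      case Nil then show ?thesis using that by simp
    next
      case (snoc \<beta> i)
      then show ?thesis using L Suc.IH[of "\<lambda>w. grad_S u w $ i"] that
        by (simp add: grad_S_multi_append)
    qed
    ultimately show "?E \<and> ?C" by blast
  next
    assume R: "?E \<and> ?C"
    have "Ck_sphere k (\<lambda>w. grad_S u w $ i)" for i
      unfolding Suc.IH snoc[symmetric] using R by simp
    moreover have "\<exists>\<Psi> g. C1_extension u \<Psi> g" using R[THEN conjunct1, rule_format, of "[]"] by simp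
    ultimately show "Ck_sphere (Suc k) u" by simp
  qed
qed simp

lemma Ck_sphere_grad:
  fixes u :: "real ^ 'd \<Rightarrow> real"
  assumes "Ck_sphere k u" "length \<beta> < k"
  shows "has_sphere_grad (grad_S_multi \<beta> u) (\<lambda>w. \<chi> j. grad_S_multi (j # \<beta>) u w)"
    and "has_sphere_grad (grad_S_multi \<beta> u) (grad_S (grad_S_multi \<beta> u))"
    and "continuous_on (sphere 0 1) (grad_S (grad_S_multi \<beta> u))"
proof -
  obtain \<Psi> g where "C1_extension (grad_S_multi \<beta> u) \<Psi> g"
    using assms Ck_sphere_iff by blast
  from C1_extension_grad_S[OF this] show "has_sphere_grad (grad_S_multi \<beta> u) (grad_S (grad_S_multi \<beta> u))"
    "continuous_on (sphere 0 1) (grad_S (grad_S_multi \<beta> u))"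
    "has_sphere_grad (grad_S_multi \<beta> u) (\<lambda>w. \<chi> j. grad_S_multi (j # \<beta>) u w)"
    by simp_all
qed

lemma has_sphere_grad_continuous:
  fixes u :: "real ^ 'd \<Rightarrow> real"
  assumes "has_sphere_grad u G"
  shows "continuous_on (sphere 0 1) u"
proof -
  have "isCont (\<lambda>x. u (sgn x)) w" if "w \<in> sphere 0 1" for w
    using assms that unfolding has_sphere_grad_def gderiv_def
    by (metis has_derivative_continuous)
  then have "continuous_on (sphere 0 1) (\<lambda>x. u (sgn x))"
    by (simp add: continuous_at_imp_continuous_on)
  then show ?thesis by (simp only: sgn_sphere cong: continuous_on_cong)
qed

lemma Ck_sphere_continuous:
  assumes "Ck_sphere k u" "length \<beta> \<le> k"
  shows "continuous_on (sphere 0 1) (grad_S_multi \<beta> u)"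
proof (cases "length \<beta> = k")
  case True then show ?thesis using assms Ck_sphere_iff by blast
next
  case False
  then show ?thesis using assms Ck_sphere_grad(2) has_sphere_grad_continuous
    by (metis le_neq_implies_less)
qed

lemma Ck_sphere_mono:
  assumes u: "Ck_sphere k u" and "m \<le> k"
  shows "Ck_sphere m u"
proof -
  have "\<exists>\<Psi> g. C1_extension (grad_S_multi \<alpha> u) \<Psi> g" if "length \<alpha> < m" for \<alpha>
  proof -
    have "length \<alpha> < k" using that \<open>m \<le> k\<close> by simp
    then show ?thesis using u unfolding Ck_sphere_iff[of k] by blast
  qed
  moreover have "continuous_on (sphere 0 1) (grad_S_multi \<alpha> u)" if "length \<alpha> = m" for \<alpha>
    using Ck_sphere_continuous[OF u] that \<open>m \<le> k\<close> by simp
  ultimately show ?thesis unfolding Ck_sphere_iff[of m] by blast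
qed

lemma Ck_sphere_cong:
  assumes "\<And>w. w \<in> sphere 0 1 \<Longrightarrow> u w = v w"
  shows "Ck_sphere k u \<longleftrightarrow> Ck_sphere k v"
proof (cases k)
  case 0
  then show ?thesis
    by (simp only: Ck_sphere.simps) (intro continuous_on_cong refl assms)
next
  case (Suc m)
  have "C1_extension u \<Psi> g \<longleftrightarrow> C1_extension v \<Psi> g" for \<Psi> g
    unfolding C1_extension_def using assms by auto
  moreover have "grad_S u = grad_S v" using assms by (rule grad_S_cong)
  ultimately show ?thesis using Suc by simp
qed

lemma Ck_norm_cong:
  assumes "\<And>w. w \<in> sphere 0 1 \<Longrightarrow> u w = v w"
  shows "Ck_norm k u = Ck_norm k v"
  unfolding Ck_norm_def
  by (intro sum.cong SUP_cong refl arg_cong[where f=abs] grad_S_multi_cong assms)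

section \<open>One step of the chain as a normalised linear map\<close>

text \<open>
  This is \<open>w \<mapsto> (I + \<eta> \<xi> \<xi>\<^sup>T) w\<close>, and \<open>shrink\<close> is the normalising factor of the step.
\<close>

definition stretch :: "real \<Rightarrow> real ^ 'd \<Rightarrow> real ^ 'd \<Rightarrow> real ^ 'd" where
  "stretch \<eta> \<xi> w = w + \<eta> *\<^sub>R ((\<xi> \<bullet> w) *\<^sub>R \<xi>)"

definition shrink :: "real \<Rightarrow> real ^ 'd \<Rightarrow> real ^ 'd \<Rightarrow> real" where
  "shrink \<eta> \<xi> w = inverse (norm (stretch \<eta> \<xi> w))"

lemma pca_step_eq_sgn: "pca_step \<eta> \<xi> w = sgn (stretch \<eta> \<xi> w)"
  by (simp add: pca_step_def stretch_def sgn_div_norm)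

lemma pca_step_sgn: "pca_step \<eta> \<xi> (sgn x) = sgn (stretch \<eta> \<xi> x)"
proof (cases "x = 0")
  case False
  have "stretch \<eta> \<xi> (sgn x) = inverse (norm x) *\<^sub>R stretch \<eta> \<xi> x"
    by (simp add: stretch_def sgn_div_norm algebra_simps)
  then show ?thesis using False by (simp add: pca_step_eq_sgn sgn_scaleR)
qed (simp add: pca_step_eq_sgn)

lemma linear_stretch: "linear (stretch \<eta> \<xi>)"
  by (rule linearI) (simp_all add: stretch_def inner_add_right algebra_simps)

lemma stretch_has_derivative: "(stretch \<eta> \<xi> has_derivative stretch \<eta> \<xi>) (at w)"
  using linear_stretch linear_conv_bounded_linear bounded_linear_imp_has_derivative by blast

lemma stretch_self_adjoint: "stretch \<eta> \<xi> v \<bullet> w = v \<bullet> stretch \<eta> \<xi> w"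
  by (simp add: stretch_def inner_add_left inner_add_right inner_commute)

text \<open>
  By Cauchy--Schwarz it is enough that \<open>w \<bullet> A w = |w|\<^sup>2 + \<eta> (\<xi> \<bullet> w)\<^sup>2\<close>.
\<close>

lemma norm_stretch_ge:
  assumes "\<eta> \<ge> 0" shows "norm w \<le> norm (stretch \<eta> \<xi> w)"
proof -
  have "w \<bullet> stretch \<eta> \<xi> w = norm w * norm w + \<eta> * ((\<xi> \<bullet> w) * (\<xi> \<bullet> w))"
    by (simp add: stretch_def inner_add_right inner_commute norm_eq_sqrt_inner)
  moreover have "\<eta> * ((\<xi> \<bullet> w) * (\<xi> \<bullet> w)) \<ge> 0" using assms by simp
  ultimately have "norm w * norm w \<le> w \<bullet> stretch \<eta> \<xi> w" by linarith
  also have "\<dots> \<le> norm w * norm (stretch \<eta> \<xi> w)" by (rule norm_cauchy_schwarz)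
  finally show ?thesis by (cases "w = 0") auto
qed

lemma stretch_nonzero: "\<eta> \<ge> 0 \<Longrightarrow> w \<in> sphere 0 1 \<Longrightarrow> stretch \<eta> \<xi> w \<noteq> 0"
  using norm_stretch_ge[of \<eta> w \<xi>] by auto

lemma shrink_bounds:
  assumes "\<eta> \<ge> 0" "w \<in> sphere 0 1"
  shows "0 < shrink \<eta> \<xi> w" "shrink \<eta> \<xi> w \<le> 1"
  using norm_stretch_ge[OF assms(1), of w \<xi>] assms(2)
  by (auto simp: shrink_def intro!: inverse_le_1_iff[THEN iffD2])

lemma has_sphere_grad_const: "has_sphere_grad (\<lambda>w. c) (\<lambda>w. 0)"
  by (simp add: has_sphere_grad_def GDERIV_const)

lemma has_sphere_grad_add:
  assumes "has_sphere_grad u G" "has_sphere_grad v H"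
  shows "has_sphere_grad (\<lambda>w. u w + v w) (\<lambda>w. G w + H w)"
  using assms by (simp add: has_sphere_grad_def GDERIV_add)

lemma has_sphere_grad_mult:
  fixes u v :: "real ^ 'd \<Rightarrow> real"
  assumes "has_sphere_grad u G" "has_sphere_grad v H"
  shows "has_sphere_grad (\<lambda>w. u w * v w) (\<lambda>w. u w *\<^sub>R H w + v w *\<^sub>R G w)"
  unfolding has_sphere_grad_def
proof
  fix w :: "real ^ 'd" assume w: "w \<in> sphere 0 1"
  show "GDERIV (\<lambda>x. u (sgn x) * v (sgn x)) w :> u w *\<^sub>R H w + v w *\<^sub>R G w"
    using GDERIV_mult[of "\<lambda>x. u (sgn x)" w "G w" "\<lambda>x. v (sgn x)" "H w"] assms w sgn_sphere[OF w]
    by (simp add: has_sphere_grad_def)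
qed

lemma has_sphere_grad_component:
  "has_sphere_grad (\<lambda>w :: real ^ 'd. w $ j) (\<lambda>w. axis j 1 - (w $ j) *\<^sub>R w)"
proof -
  have "GDERIV (\<lambda>w. w $ j) w :> axis j 1" for w :: "real ^ 'd"
    unfolding gderiv_def
    by (simp add: inner_axis bounded_linear_imp_has_derivative bounded_linear_vec_nth)
  from has_sphere_grad_of_GDERIV[OF this] show ?thesis
    by (simp add: tangential_def inner_axis)
qed

text \<open>
  The decisive point is the factor \<open>\<eta>\<close>. The gradient of \<open>x \<mapsto> 1 / |A x|\<close> is \<open>- r\<^sup>3 A\<^sup>2 w\<close>, and
  \<open>A\<^sup>2 w = w + \<eta> c \<xi>\<close> with \<open>c = (\<xi> \<bullet> w) (2 + \<eta> |\<xi>|\<^sup>2)\<close>; the summand \<open>w\<close> is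
  normal to the sphere and is projected away.
\<close>

lemma has_sphere_grad_shrink:
  fixes \<xi> :: "real ^ 'd"
  assumes "\<eta> \<ge> 0"
  shows "has_sphere_grad (shrink \<eta> \<xi>) (\<lambda>w. \<eta> *\<^sub>R (((shrink \<eta> \<xi> w) ^ 3 * ((\<xi> \<bullet> w) * (2 + \<eta> * (\<xi> \<bullet> \<xi>)))) *\<^sub>R
      ((\<xi> \<bullet> w) *\<^sub>R w - \<xi>)))"
proof -
  let ?L = "stretch \<eta> \<xi>" and ?r = "shrink \<eta> \<xi>"
  have D: "GDERIV ?r w :> - ((?r w) ^ 3) *\<^sub>R ?L (?L w)" if w: "w \<in> sphere 0 1" for w
  proof -
    have nz: "?L w \<noteq> 0" using stretch_nonzero[OF assms w] .
    have "(norm has_derivative (\<lambda>h. h \<bullet> sgn (?L w))) (at (?L w))"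
      using GDERIV_norm[OF nz] by (simp add: gderiv_def)
    from has_derivative_compose[OF stretch_has_derivative this]
    have "GDERIV (\<lambda>x. norm (?L x)) w :> ?L (sgn (?L w))"
      by (simp add: gderiv_def stretch_self_adjoint)
    from GDERIV_inverse[OF this]
    have "GDERIV ?r w :> - (?r w)\<^sup>2 *\<^sub>R ?L (sgn (?L w))" using nz by (simp add: shrink_def[abs_def])
    moreover have "?L (sgn (?L w)) = ?r w *\<^sub>R ?L (?L w)"
      by (simp add: sgn_div_norm shrink_def linear_scale[OF linear_stretch])
    ultimately show ?thesis by (simp add: power3_eq_cube power2_eq_square)
  qed
  show ?thesis
  proof (rule has_sphere_grad_transform[OF has_sphere_grad_of_GDERIV[OF D] refl])
    fix w :: "real ^ 'd" assume w: "w \<in> sphere 0 1"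
    then have ww: "w \<bullet> w = 1" by (simp add: dot_square_norm)
    let ?p = "\<xi> \<bullet> w" and ?c = "(\<xi> \<bullet> w) * (2 + \<eta> * (\<xi> \<bullet> \<xi>))"
    have LL: "?L (?L w) = w + (\<eta> * ?c) *\<^sub>R \<xi>"
      by (simp add: stretch_def inner_add_right algebra_simps flip: scaleR_add_left)
    have "tangential w (- ((?r w) ^ 3) *\<^sub>R ?L (?L w)) = - ((?r w) ^ 3) *\<^sub>R tangential w (?L (?L w))"
      by (simp add: tangential_def algebra_simps)
    also have "tangential w (?L (?L w)) = (\<eta> * ?c) *\<^sub>R (\<xi> - ?p *\<^sub>R w)"
      unfolding LL tangential_def
      by (simp add: inner_add_right ww inner_commute[of w \<xi>] algebra_simps)
    finally show "tangential w (- ((?r w) ^ 3) *\<^sub>R ?L (?L w)) = \<eta> *\<^sub>R (((?r w) ^ 3 * ?c) *\<^sub>R (?p *\<^sub>R w - \<xi>))"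
      by (simp add: scaleR_diff_right algebra_simps)
  qed
qed

text \<open>
  The radial extension of \<open>u \<circ> \<tau>\<close> is the radial extension of \<open>u\<close> composed with the linear map \<open>A\<close>, and \<open>A\<close> is its
  own adjoint.
\<close>

lemma has_sphere_grad_pca_step:
  fixes u :: "real ^ 'd \<Rightarrow> real"
  assumes u: "has_sphere_grad u G" and "\<eta> \<ge> 0"
  shows "has_sphere_grad (\<lambda>w. u (pca_step \<eta> \<xi> w))
    (\<lambda>w. shrink \<eta> \<xi> w *\<^sub>R stretch \<eta> \<xi> (G (pca_step \<eta> \<xi> w)))"
  unfolding has_sphere_grad_def pca_step_sgn
proof
  fix w :: "real ^ 'd" assume w: "w \<in> sphere 0 1"
  let ?L = "stretch \<eta> \<xi>"
  have "?L w \<noteq> 0" using stretch_nonzero[OF \<open>\<eta> \<ge> 0\<close> w] .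
  then have "((\<lambda>x. u (sgn x)) has_derivative (\<lambda>h. h \<bullet> (G (sgn (?L w)) /\<^sub>R norm (?L w)))) (at (?L w))"
    using has_sphere_grad_GDERIV[OF u] by (simp add: gderiv_def)
  from has_derivative_compose[OF stretch_has_derivative this]
  show "GDERIV (\<lambda>x. u (sgn (?L x))) w :> shrink \<eta> \<xi> w *\<^sub>R ?L (G (pca_step \<eta> \<xi> w))"
    by (simp add: gderiv_def stretch_self_adjoint shrink_def pca_step_eq_sgn)
qed


section \<open>The algebra of coefficients\<close>

text \<open>
  Polynomials in \<open>\<eta>\<close>, the components of \<open>\<xi>\<close> and \<open>w\<close>, and \<open>r\<close>. Generating the coefficients
  inductively means that closure under the gradient, joint continuity in \<open>(\<xi>, w)\<close> and bounds that are uniform in \<open>\<eta>\<close> are each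
  checked on the generators.
\<close>

inductive coef :: "(real \<Rightarrow> real ^ 'd \<Rightarrow> real ^ 'd \<Rightarrow> real) \<Rightarrow> bool" where
  coef_const: "coef (\<lambda>\<eta> \<xi> w. c)"
| coef_rate: "coef (\<lambda>\<eta> \<xi> w. \<eta>)"
| coef_sample: "coef (\<lambda>\<eta> \<xi> w. \<xi> $ i)"
| coef_point: "coef (\<lambda>\<eta> \<xi> w. w $ i)"
| coef_shrink: "coef (\<lambda>\<eta> \<xi> w. shrink \<eta> \<xi> w)"
| coef_add: "coef a \<Longrightarrow> coef b \<Longrightarrow> coef (\<lambda>\<eta> \<xi> w. a \<eta> \<xi> w + b \<eta> \<xi> w)"
| coef_mult: "coef a \<Longrightarrow> coef b \<Longrightarrow> coef (\<lambda>\<eta> \<xi> w. a \<eta> \<xi> w * b \<eta> \<xi> w)"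

lemma coef_sum:
  assumes "finite A" "\<And>j. j \<in> A \<Longrightarrow> coef (b j)"
  shows "coef (\<lambda>\<eta> \<xi> w. \<Sum>j\<in>A. b j \<eta> \<xi> w)"
  using assms by (induction A) (auto intro: coef_const coef_add)

lemma coef_power: "coef b \<Longrightarrow> coef (\<lambda>\<eta> \<xi> w. b \<eta> \<xi> w ^ n)"
  by (induction n) (auto intro: coef_const coef_mult)

lemma coef_diff: "coef a \<Longrightarrow> coef b \<Longrightarrow> coef (\<lambda>\<eta> \<xi> w. a \<eta> \<xi> w - b \<eta> \<xi> w)"
  using coef_add[OF _ coef_mult[OF coef_const[of "- 1"]], of a b] by simp

lemma coef_inner_point: "coef (\<lambda>\<eta> \<xi> w. \<xi> \<bullet> w)"
  unfolding inner_vec_def inner_real_def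
  by (intro coef_sum coef_mult coef_sample coef_point) simp

lemma coef_inner_sample: "coef (\<lambda>\<eta> \<xi> w. \<xi> \<bullet> \<xi>)"
  unfolding inner_vec_def inner_real_def
  by (intro coef_sum coef_mult coef_sample) simp

lemmas coef_intros = coef_const coef_rate coef_sample coef_point coef_shrink coef_add coef_mult
  coef_power coef_diff coef_inner_point coef_inner_sample

lemma shrink_grad_coef:
  "\<exists>D :: 'd \<Rightarrow> real \<Rightarrow> real ^ 'd \<Rightarrow> real ^ 'd \<Rightarrow> real. (\<forall>i. coef (D i)) \<and>
    (\<forall>\<eta> \<xi>. \<eta> \<ge> 0 \<longrightarrow> has_sphere_grad (shrink \<eta> \<xi>) (\<lambda>w. \<chi> i. \<eta> * D i \<eta> \<xi> w))"
proof (intro exI conjI allI impI)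
  let ?D = "\<lambda>i \<eta> \<xi> w. (shrink \<eta> \<xi> w) ^ 3 * ((\<xi> \<bullet> w) * (2 + \<eta> * (\<xi> \<bullet> \<xi>))) * ((\<xi> \<bullet> w) * w $ i - \<xi> $ i)"
  show "coef (?D i)" for i :: 'd by (intro coef_intros)
  show "has_sphere_grad (shrink \<eta> \<xi>) (\<lambda>w. \<chi> i. \<eta> * ?D i \<eta> \<xi> w)" if "\<eta> \<ge> 0" for \<eta> and \<xi> :: "real ^ 'd"
    by (rule has_sphere_grad_transform[OF has_sphere_grad_shrink[OF that] refl])
       (simp add: vec_eq_iff)
qed

text \<open>
  The leading term of a derivative of order \<open>m\<close> of \<open>u \<circ> \<tau>\<close> has the factor \<open>r\<^sup>m\<close>; because differentiating this factor
  produces an \<open>\<eta>\<close>, the result can be moved into the error term.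
\<close>

lemma shrink_power_grad_coef:
  "\<exists>D :: 'd \<Rightarrow> real \<Rightarrow> real ^ 'd \<Rightarrow> real ^ 'd \<Rightarrow> real. (\<forall>i. coef (D i)) \<and>
    (\<forall>\<eta> \<xi>. \<eta> \<ge> 0 \<longrightarrow> has_sphere_grad (\<lambda>w. shrink \<eta> \<xi> w ^ m) (\<lambda>w. \<chi> i. \<eta> * D i \<eta> \<xi> w))"
proof (induction m)
  case 0
  have "has_sphere_grad (\<lambda>w. 1) (\<lambda>w :: real ^ 'd. \<chi> i. \<eta> * 0)" for \<eta> :: real
    using has_sphere_grad_const[of 1] by (simp add: zero_vec_def)
  then show ?case using coef_const[of 0] by (intro exI[of _ "\<lambda>i \<eta> \<xi> w. 0"]) simp
next
  case (Suc m)
  obtain D :: "'d \<Rightarrow> real \<Rightarrow> real ^ 'd \<Rightarrow> real ^ 'd \<Rightarrow> real" where D: "\<And>i. coef (D i)"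
    "\<And>\<eta> \<xi>. \<eta> \<ge> 0 \<Longrightarrow> has_sphere_grad (\<lambda>w. shrink \<eta> \<xi> w ^ m) (\<lambda>w. \<chi> i. \<eta> * D i \<eta> \<xi> w)"
    using Suc by blast
  obtain R :: "'d \<Rightarrow> real \<Rightarrow> real ^ 'd \<Rightarrow> real ^ 'd \<Rightarrow> real" where R: "\<And>i. coef (R i)"
    "\<And>\<eta> \<xi>. \<eta> \<ge> 0 \<Longrightarrow> has_sphere_grad (shrink \<eta> \<xi>) (\<lambda>w. \<chi> i. \<eta> * R i \<eta> \<xi> w)"
    using shrink_grad_coef by blast
  let ?D = "\<lambda>i \<eta> \<xi> w. shrink \<eta> \<xi> w * D i \<eta> \<xi> w + shrink \<eta> \<xi> w ^ m * R i \<eta> \<xi> w"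
  have "coef (?D i)" for i by (intro coef_intros D R)
  moreover have "has_sphere_grad (\<lambda>w. shrink \<eta> \<xi> w ^ Suc m) (\<lambda>w. \<chi> i. \<eta> * ?D i \<eta> \<xi> w)"
    if "\<eta> \<ge> 0" for \<eta> \<xi>
    by (rule has_sphere_grad_transform[OF has_sphere_grad_mult[OF R(2)[OF that] D(2)[OF that]]])
       (simp, simp add: vec_eq_iff algebra_simps)
  ultimately show ?case by (intro exI[of _ ?D]) blast
qed

lemma coef_grad:
  assumes "coef b"
  shows "\<exists>D. (\<forall>i. coef (D i)) \<and>
    (\<forall>\<eta> \<xi>. \<eta> \<ge> 0 \<longrightarrow> has_sphere_grad (b \<eta> \<xi>) (\<lambda>w. \<chi> i. D i \<eta> \<xi> w))"
  using assms
proof induction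
  case (coef_point j)
  let ?D = "\<lambda>i \<eta> \<xi> w :: real ^ 'a. (if i = j then 1 else 0) - w $ j * w $ i"
  have "coef (?D i)" for i by (intro coef_intros)
  moreover have "has_sphere_grad (\<lambda>w. w $ j) (\<lambda>w. \<chi> i. ?D i \<eta> \<xi> w)" for \<eta> \<xi>
    by (rule has_sphere_grad_transform[OF has_sphere_grad_component refl])
       (simp add: vec_eq_iff axis_def)
  ultimately show ?case by (intro exI[of _ ?D]) blast
next
  case coef_shrink
  obtain R :: "'a \<Rightarrow> real \<Rightarrow> real ^ 'a \<Rightarrow> real ^ 'a \<Rightarrow> real" where R: "\<And>i. coef (R i)"
    "\<And>\<eta> \<xi>. \<eta> \<ge> 0 \<Longrightarrow> has_sphere_grad (shrink \<eta> \<xi>) (\<lambda>w. \<chi> i. \<eta> * R i \<eta> \<xi> w)"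
    using shrink_grad_coef by blast
  have "coef (\<lambda>\<eta> \<xi> w. \<eta> * R i \<eta> \<xi> w)" for i by (intro coef_intros R)
  then show ?case using R(2) by (intro exI[of _ "\<lambda>i \<eta> \<xi> w. \<eta> * R i \<eta> \<xi> w"]) blast
next
  case (coef_add a b)
  then obtain D E where D: "\<And>i. coef (D i)"
      "\<And>\<eta> \<xi>. \<eta> \<ge> 0 \<Longrightarrow> has_sphere_grad (a \<eta> \<xi>) (\<lambda>w. \<chi> i. D i \<eta> \<xi> w)"
    and E: "\<And>i. coef (E i)"
      "\<And>\<eta> \<xi>. \<eta> \<ge> 0 \<Longrightarrow> has_sphere_grad (b \<eta> \<xi>) (\<lambda>w. \<chi> i. E i \<eta> \<xi> w)"
    by blast
  let ?D = "\<lambda>i \<eta> \<xi> w. D i \<eta> \<xi> w + E i \<eta> \<xi> w"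
  have "coef (?D i)" for i by (intro coef_intros D E)
  moreover have "has_sphere_grad (\<lambda>w. a \<eta> \<xi> w + b \<eta> \<xi> w) (\<lambda>w. \<chi> i. ?D i \<eta> \<xi> w)"
    if "\<eta> \<ge> 0" for \<eta> \<xi>
    by (rule has_sphere_grad_transform[OF has_sphere_grad_add[OF D(2)[OF that] E(2)[OF that]]])
       (simp, simp add: vec_eq_iff)
  ultimately show ?case by (intro exI[of _ ?D]) blast
next
  case (coef_mult a b)
  then obtain D E where D: "\<And>i. coef (D i)"
      "\<And>\<eta> \<xi>. \<eta> \<ge> 0 \<Longrightarrow> has_sphere_grad (a \<eta> \<xi>) (\<lambda>w. \<chi> i. D i \<eta> \<xi> w)"
    and E: "\<And>i. coef (E i)"
      "\<And>\<eta> \<xi>. \<eta> \<ge> 0 \<Longrightarrow> has_sphere_grad (b \<eta> \<xi>) (\<lambda>w. \<chi> i. E i \<eta> \<xi> w)"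
    by blast
  let ?D = "\<lambda>i \<eta> \<xi> w. a \<eta> \<xi> w * E i \<eta> \<xi> w + b \<eta> \<xi> w * D i \<eta> \<xi> w"
  have "coef (?D i)" for i by (intro coef_intros D E coef_mult.hyps)
  moreover have "has_sphere_grad (\<lambda>w. a \<eta> \<xi> w * b \<eta> \<xi> w) (\<lambda>w. \<chi> i. ?D i \<eta> \<xi> w)"
    if "\<eta> \<ge> 0" for \<eta> \<xi>
    by (rule has_sphere_grad_transform[OF has_sphere_grad_mult[OF D(2)[OF that] E(2)[OF that]]])
       (simp, simp add: vec_eq_iff)
  ultimately show ?case by (intro exI[of _ ?D]) blast
qed (auto intro!: exI[of _ "\<lambda>i \<eta> \<xi> w. 0"] coef_const
      has_sphere_grad_const[unfolded zero_vec_def])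

lemma coef_continuous:
  assumes "coef b" "\<eta> \<ge> 0"
  shows "continuous_on (UNIV \<times> sphere 0 1) (\<lambda>p. b \<eta> (fst p) (snd p))"
  using assms(1)
proof induction
  case coef_shrink
  have "norm (stretch \<eta> \<xi> w) \<noteq> 0" if "norm w = 1" for \<xi> w :: "real ^ 'a"
    using stretch_nonzero[OF \<open>\<eta> \<ge> 0\<close>] that by simp
  then show ?case unfolding shrink_def stretch_def by (intro continuous_intros) auto
qed (auto intro!: continuous_intros)

lemma coef_bounded:
  assumes "coef b" "R \<ge> 0"
  shows "\<exists>K\<ge>0. \<forall>\<eta> \<xi> w. 0 \<le> \<eta> \<and> \<eta> \<le> 1 \<and> norm \<xi> \<le> R \<and> w \<in> sphere 0 1 \<longrightarrow> \<bar>b \<eta> \<xi> w\<bar> \<le> K"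
  using assms(1)
proof induction
  case (coef_const c) then show ?case by (intro exI[of _ "\<bar>c\<bar>"]) auto
next
  case coef_rate then show ?case by (intro exI[of _ 1]) auto
next
  case (coef_sample i)
  have "\<bar>\<xi> $ i\<bar> \<le> R" if "norm \<xi> \<le> R" for \<xi> :: "real ^ 'a"
    using component_le_norm_cart[of \<xi> i] that by linarith
  then show ?case using \<open>R \<ge> 0\<close> by (intro exI[of _ R]) auto
next
  case (coef_point i)
  have "\<bar>w $ i\<bar> \<le> 1" if "w \<in> sphere 0 1" for w :: "real ^ 'a"
    using component_le_norm_cart[of w i] that by simp
  then show ?case by (intro exI[of _ 1]) auto
next
  case coef_shrink
  have "\<bar>shrink \<eta> \<xi> w\<bar> \<le> 1" if "\<eta> \<ge> 0" "w \<in> sphere 0 1" for \<eta> and \<xi> w :: "real ^ 'a"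
    using shrink_bounds[OF that, of \<xi>] by simp
  then show ?case by (intro exI[of _ 1]) auto
next
  case (coef_add a b)
  then obtain K L where K: "K \<ge> 0" "\<And>\<eta> \<xi> w. 0 \<le> \<eta> \<Longrightarrow> \<eta> \<le> 1 \<Longrightarrow> norm \<xi> \<le> R \<Longrightarrow> w \<in> sphere 0 1 \<Longrightarrow> \<bar>a \<eta> \<xi> w\<bar> \<le> K"
    and L: "L \<ge> 0" "\<And>\<eta> \<xi> w. 0 \<le> \<eta> \<Longrightarrow> \<eta> \<le> 1 \<Longrightarrow> norm \<xi> \<le> R \<Longrightarrow> w \<in> sphere 0 1 \<Longrightarrow> \<bar>b \<eta> \<xi> w\<bar> \<le> L"
    by blast
  show ?case using K(1) L(1)
    by (intro exI[of _ "K + L"]) (auto intro!: order_trans[OF abs_triangle_ineq] add_mono K(2) L(2))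
next
  case (coef_mult a b)
  then obtain K L where K: "K \<ge> 0" "\<And>\<eta> \<xi> w. 0 \<le> \<eta> \<Longrightarrow> \<eta> \<le> 1 \<Longrightarrow> norm \<xi> \<le> R \<Longrightarrow> w \<in> sphere 0 1 \<Longrightarrow> \<bar>a \<eta> \<xi> w\<bar> \<le> K"
    and L: "L \<ge> 0" "\<And>\<eta> \<xi> w. 0 \<le> \<eta> \<Longrightarrow> \<eta> \<le> 1 \<Longrightarrow> norm \<xi> \<le> R \<Longrightarrow> w \<in> sphere 0 1 \<Longrightarrow> \<bar>b \<eta> \<xi> w\<bar> \<le> L"
    by blast
  show ?case using K(1) L(1)
    by (intro exI[of _ "K * L"]) (auto simp: abs_mult intro!: mult_mono K(2) L(2))
qed

section \<open>Derivatives of a function composed with one step\<close>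

text \<open>
  The error terms of order \<open>m\<close>: sums of coefficients times derivatives of \<open>u\<close>, of order at most \<open>m\<close>, at the
  image point. Treating them as operators in \<open>u\<close> makes it possible to choose them, and later the constants that bound
  them, independently of \<open>u\<close>, \<open>\<eta>\<close> and \<open>\<xi>\<close>.
\<close>

inductive remainder ::
    "nat \<Rightarrow> ((real ^ 'd \<Rightarrow> real) \<Rightarrow> real \<Rightarrow> real ^ 'd \<Rightarrow> real ^ 'd \<Rightarrow> real) \<Rightarrow> bool" for m where
  remainder_term: "coef b \<Longrightarrow> length \<beta> \<le> m \<Longrightarrow>
    remainder m (\<lambda>u \<eta> \<xi> w. b \<eta> \<xi> w * grad_S_multi \<beta> u (pca_step \<eta> \<xi> w))"
| remainder_add: "remainder m E \<Longrightarrow> remainder m F \<Longrightarrow>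
    remainder m (\<lambda>u \<eta> \<xi> w. E u \<eta> \<xi> w + F u \<eta> \<xi> w)"

lemma remainder_zero: "remainder m (\<lambda>u \<eta> \<xi> w. 0)"
  using remainder_term[OF coef_const[of 0], of "[]" m] by simp

lemma remainder_sum:
  assumes "finite A" "\<And>j. j \<in> A \<Longrightarrow> remainder m (E j)"
  shows "remainder m (\<lambda>u \<eta> \<xi> w. \<Sum>j\<in>A. E j u \<eta> \<xi> w)"
  using assms by (induction A) (auto intro: remainder_zero remainder_add)

text \<open>
  The components of \<open>r A v = r v + \<eta> r (\<xi> \<bullet> v) \<xi>\<close> for \<open>v = (\<nabla>\<^sub>S \<nabla>\<^sub>S\<^sup>\<beta> u) (\<tau> w)\<close>.
\<close>

lemma has_sphere_grad_grad_S_multi_pca_step: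
  assumes u: "Ck_sphere k u" "length \<beta> < k" and "\<eta> \<ge> 0"
  shows "has_sphere_grad (\<lambda>w. grad_S_multi \<beta> u (pca_step \<eta> \<xi> w))
    (\<lambda>w. \<chi> i. shrink \<eta> \<xi> w * grad_S_multi (i # \<beta>) u (pca_step \<eta> \<xi> w) +
       \<eta> * (\<Sum>j\<in>UNIV. (shrink \<eta> \<xi> w * (\<xi> $ i * \<xi> $ j)) * grad_S_multi (j # \<beta>) u (pca_step \<eta> \<xi> w)))"
  by (rule has_sphere_grad_transform[OF has_sphere_grad_pca_step[OF Ck_sphere_grad(1)[OF u] \<open>\<eta> \<ge> 0\<close>] refl])
     (simp add: vec_eq_iff stretch_def inner_vec_def algebra_simps sum_distrib_left
       del: grad_S_multi.simps)

lemma remainder_grad: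
  assumes "remainder m E"
  shows "\<exists>D. (\<forall>i. remainder (Suc m) (D i)) \<and>
    (\<forall>\<eta> \<xi> u. \<eta> \<ge> 0 \<longrightarrow> Ck_sphere (Suc m) u \<longrightarrow>
      has_sphere_grad (E u \<eta> \<xi>) (\<lambda>w. \<chi> i. D i u \<eta> \<xi> w))"
  using assms
proof induction
  case (remainder_term b \<beta>)
  then obtain C where C: "\<And>i. coef (C i)"
    "\<And>\<eta> \<xi>. \<eta> \<ge> 0 \<Longrightarrow> has_sphere_grad (b \<eta> \<xi>) (\<lambda>w. \<chi> i. C i \<eta> \<xi> w)"
    using coef_grad by blast
  let ?N = "\<lambda>\<gamma> u \<eta> \<xi> w. grad_S_multi \<gamma> u (pca_step \<eta> \<xi> w)"
  let ?D = "\<lambda>i u \<eta> \<xi> w. C i \<eta> \<xi> w * ?N \<beta> u \<eta> \<xi> w +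
    ((b \<eta> \<xi> w * shrink \<eta> \<xi> w) * ?N (i # \<beta>) u \<eta> \<xi> w +
     (\<Sum>j\<in>UNIV. (b \<eta> \<xi> w * \<eta> * (shrink \<eta> \<xi> w * (\<xi> $ i * \<xi> $ j))) * ?N (j # \<beta>) u \<eta> \<xi> w))"
  have "remainder (Suc m) (?D i)" for i
    using remainder_term C(1)
    by (intro remainder.intros remainder_sum coef_intros) (auto intro: coef_intros)
  moreover have "has_sphere_grad (\<lambda>w. b \<eta> \<xi> w * ?N \<beta> u \<eta> \<xi> w) (\<lambda>w. \<chi> i. ?D i u \<eta> \<xi> w)"
    if "\<eta> \<ge> 0" "Ck_sphere (Suc m) u" for \<eta> \<xi> u
  proof -
    have l: "length \<beta> < Suc m" using remainder_term by simp
    show ?thesis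
      by (rule has_sphere_grad_transform[OF has_sphere_grad_mult[OF C(2)[OF that(1)]
            has_sphere_grad_grad_S_multi_pca_step[OF that(2) l that(1)]] refl])
         (simp add: vec_eq_iff algebra_simps sum_distrib_left del: grad_S_multi.simps)
  qed
  ultimately show ?case by (intro exI[of _ ?D]) blast
next
  case (remainder_add E F)
  then obtain C D where C: "\<And>i. remainder (Suc m) (C i)"
    "\<And>\<eta> \<xi> u. \<eta> \<ge> 0 \<Longrightarrow> Ck_sphere (Suc m) u \<Longrightarrow> has_sphere_grad (E u \<eta> \<xi>) (\<lambda>w. \<chi> i. C i u \<eta> \<xi> w)"
    and D: "\<And>i. remainder (Suc m) (D i)"
    "\<And>\<eta> \<xi> u. \<eta> \<ge> 0 \<Longrightarrow> Ck_sphere (Suc m) u \<Longrightarrow> has_sphere_grad (F u \<eta> \<xi>) (\<lambda>w. \<chi> i. D i u \<eta> \<xi> w)"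
    by blast
  let ?D = "\<lambda>i u \<eta> \<xi> w. C i u \<eta> \<xi> w + D i u \<eta> \<xi> w"
  have "remainder (Suc m) (?D i)" for i by (intro remainder.remainder_add C D)
  moreover have "has_sphere_grad (\<lambda>w. E u \<eta> \<xi> w + F u \<eta> \<xi> w) (\<lambda>w. \<chi> i. ?D i u \<eta> \<xi> w)"
    if "\<eta> \<ge> 0" "Ck_sphere (Suc m) u" for \<eta> \<xi> u
    by (rule has_sphere_grad_transform[OF has_sphere_grad_add[OF C(2)[OF that] D(2)[OF that]] refl])
       (simp add: vec_eq_iff)
  ultimately show ?case by (intro exI[of _ ?D]) blast
qed

lemma continuous_pca_step:
  assumes "\<eta> \<ge> 0"
  shows "continuous_on (UNIV \<times> sphere 0 1) (\<lambda>p :: (real ^ 'd) \<times> (real ^ 'd). pca_step \<eta> (fst p) (snd p))"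
proof -
  have "norm (stretch \<eta> \<xi> w) \<noteq> 0" if "norm w = 1" for \<xi> w :: "real ^ 'd"
    using stretch_nonzero[OF assms] that by simp
  then show ?thesis unfolding pca_step_eq_sgn sgn_div_norm stretch_def
    by (intro continuous_intros) auto
qed

lemma continuous_compose_pca_step:
  fixes f :: "real ^ 'd \<Rightarrow> real"
  assumes "continuous_on (sphere 0 1) f" "\<eta> \<ge> 0"
  shows "continuous_on (UNIV \<times> sphere 0 1) (\<lambda>p. f (pca_step \<eta> (fst p) (snd p)))"
proof (rule continuous_on_compose2[OF assms(1) continuous_pca_step[OF assms(2)]])
  show "(\<lambda>p. pca_step \<eta> (fst p) (snd p)) ` (UNIV \<times> sphere 0 1) \<subseteq> sphere 0 1"
    using pca_step_sphere[OF assms(2)] by (force simp del: mem_sphere_0)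
qed

lemma remainder_continuous:
  assumes "remainder m E" "Ck_sphere m u" "\<eta> \<ge> 0"
  shows "continuous_on (UNIV \<times> sphere 0 1) (\<lambda>p. E u \<eta> (fst p) (snd p))"
  using assms(1)
proof induction
  case (remainder_term b \<beta>)
  then show ?case
    using Ck_sphere_continuous[OF assms(2)] assms(3)
    by (intro continuous_on_mult coef_continuous continuous_compose_pca_step)
qed (auto intro!: continuous_intros)

definition pullback_expansion ::
    "'d list \<Rightarrow> ((real ^ 'd \<Rightarrow> real) \<Rightarrow> real \<Rightarrow> real ^ 'd \<Rightarrow> real ^ 'd \<Rightarrow> real) \<Rightarrow>
     (real ^ 'd \<Rightarrow> real) \<Rightarrow> real \<Rightarrow> real ^ 'd \<Rightarrow> real ^ 'd \<Rightarrow> real" where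
  "pullback_expansion \<alpha> E u \<eta> \<xi> w =
     shrink \<eta> \<xi> w ^ length \<alpha> * grad_S_multi \<alpha> u (pca_step \<eta> \<xi> w) + \<eta> * E u \<eta> \<xi> w"

lemma pullback_expansion_continuous:
  assumes "remainder (length \<alpha>) E" "Ck_sphere (length \<alpha>) u" "\<eta> \<ge> 0"
  shows "continuous_on (UNIV \<times> sphere 0 1) (\<lambda>p. pullback_expansion \<alpha> E u \<eta> (fst p) (snd p))"
  unfolding pullback_expansion_def
  by (intro continuous_on_add continuous_on_mult continuous_on_const remainder_continuous[OF assms]
      coef_continuous[OF coef_power[OF coef_shrink] assms(3)]
      continuous_compose_pca_step[OF Ck_sphere_continuous[OF assms(2) order_refl] assms(3)])

lemma continuous_on_section:
  assumes "continuous_on (UNIV \<times> S) (\<lambda>p. f (fst p) (snd p))"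
  shows "continuous_on S (f \<xi>)"
proof -
  have "continuous_on S (\<lambda>w. (\<xi>, w))" by (intro continuous_intros)
  from continuous_on_compose2[OF assms this] show ?thesis by auto
qed

text \<open>
  Three contributions enter the new error term: the derivative of \<open>r\<^sup>m\<close>, which has a factor \<open>\<eta>\<close>; the part
  \<open>\<eta> r (\<xi> \<bullet> v) \<xi>\<close> of the chain rule; and the derivative of the old error. What remains is \<open>r\<^bsup>m + 1\<^esup>\<close> times one more
  derivative of \<open>u\<close>, with the same direction \<open>i\<close>.
\<close>

lemma pullback_expansion_grad:
  fixes \<alpha> :: "'d :: finite list"
  assumes "remainder (length \<alpha>) E"
  shows "\<exists>D. (\<forall>i. remainder (Suc (length \<alpha>)) (D i)) \<and>
    (\<forall>\<eta> \<xi> u. \<eta> \<ge> 0 \<longrightarrow> Ck_sphere (Suc (length \<alpha>)) u \<longrightarrow>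
      has_sphere_grad (pullback_expansion \<alpha> E u \<eta> \<xi>)
        (\<lambda>w. \<chi> i. pullback_expansion (i # \<alpha>) (D i) u \<eta> \<xi> w))"
proof -
  let ?m = "length \<alpha>"
  let ?N = "\<lambda>\<gamma> u \<eta> \<xi> w. grad_S_multi \<gamma> u (pca_step \<eta> \<xi> w)"
  obtain C :: "'d \<Rightarrow> real \<Rightarrow> real ^ 'd \<Rightarrow> real ^ 'd \<Rightarrow> real" where C: "\<And>i. coef (C i)"
    "\<And>\<eta> \<xi>. \<eta> \<ge> 0 \<Longrightarrow> has_sphere_grad (\<lambda>w. shrink \<eta> \<xi> w ^ ?m) (\<lambda>w. \<chi> i. \<eta> * C i \<eta> \<xi> w)"
    using shrink_power_grad_coef by blast
  obtain F where F: "\<And>i. remainder (Suc ?m) (F i)"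
    "\<And>\<eta> \<xi> u. \<eta> \<ge> 0 \<Longrightarrow> Ck_sphere (Suc ?m) u \<Longrightarrow> has_sphere_grad (E u \<eta> \<xi>) (\<lambda>w. \<chi> i. F i u \<eta> \<xi> w)"
    using remainder_grad[OF assms] by blast
  let ?D = "\<lambda>i u \<eta> \<xi> w. C i \<eta> \<xi> w * ?N \<alpha> u \<eta> \<xi> w +
    ((\<Sum>j\<in>UNIV. (shrink \<eta> \<xi> w ^ ?m * (shrink \<eta> \<xi> w * (\<xi> $ i * \<xi> $ j))) * ?N (j # \<alpha>) u \<eta> \<xi> w) +
     F i u \<eta> \<xi> w)"
  have "remainder (Suc ?m) (?D i)" for i
    using C(1) F(1)
    by (intro remainder.intros remainder_sum coef_intros) (auto intro: coef_intros)
  moreover have "has_sphere_grad (pullback_expansion \<alpha> E u \<eta> \<xi>)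
        (\<lambda>w. \<chi> i. pullback_expansion (i # \<alpha>) (?D i) u \<eta> \<xi> w)"
    if "\<eta> \<ge> 0" "Ck_sphere (Suc ?m) u" for \<eta> \<xi> u
    unfolding pullback_expansion_def
    by (rule has_sphere_grad_transform[OF has_sphere_grad_add[OF has_sphere_grad_mult[OF C(2)[OF that(1)]
            has_sphere_grad_grad_S_multi_pca_step[OF that(2) lessI that(1)]]
            has_sphere_grad_mult[OF has_sphere_grad_const F(2)[OF that]]] refl])
       (simp add: vec_eq_iff algebra_simps sum_distrib_left del: grad_S_multi.simps)
  ultimately show ?thesis by (intro exI[of _ ?D]) blast
qed

text \<open>
  The error \<open>E\<close> depends on \<open>\<alpha>\<close> alone. This uniformity is what allows the constant in the final bound to be
  independent of \<open>\<eta>\<close>, of the sample and of \<open>u\<close>.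
\<close>

lemma grad_S_multi_pca_step:
  "\<exists>E. remainder (length \<alpha>) E \<and>
    (\<forall>\<eta> \<xi> u. \<eta> \<ge> 0 \<longrightarrow> Ck_sphere (length \<alpha>) u \<longrightarrow>
      (\<forall>w\<in>sphere 0 1. grad_S_multi \<alpha> (\<lambda>w. u (pca_step \<eta> \<xi> w)) w = pullback_expansion \<alpha> E u \<eta> \<xi> w))"
proof (induction \<alpha>)
  case Nil
  show ?case
    by (intro exI[of _ "\<lambda>u \<eta> \<xi> w. 0"] conjI remainder_zero) (simp add: pullback_expansion_def)
next
  case (Cons i \<alpha>)
  then obtain E where E: "remainder (length \<alpha>) E"
    "\<And>\<eta> \<xi> u w. \<eta> \<ge> 0 \<Longrightarrow> Ck_sphere (length \<alpha>) u \<Longrightarrow> w \<in> sphere 0 1 \<Longrightarrow>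
       grad_S_multi \<alpha> (\<lambda>w. u (pca_step \<eta> \<xi> w)) w = pullback_expansion \<alpha> E u \<eta> \<xi> w"
    by blast
  from pullback_expansion_grad[OF E(1)] obtain D
    where "\<forall>i. remainder (Suc (length \<alpha>)) (D i)"
    and "\<forall>\<eta> \<xi> u. \<eta> \<ge> 0 \<longrightarrow> Ck_sphere (Suc (length \<alpha>)) u \<longrightarrow>
      has_sphere_grad (pullback_expansion \<alpha> E u \<eta> \<xi>)
        (\<lambda>w. \<chi> i. pullback_expansion (i # \<alpha>) (D i) u \<eta> \<xi> w)"
    by (elim exE conjE)
  note D = this[rule_format]
  have "grad_S_multi (i # \<alpha>) (\<lambda>w. u (pca_step \<eta> \<xi> w)) w = pullback_expansion (i # \<alpha>) (D i) u \<eta> \<xi> w"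
    if h: "\<eta> \<ge> 0" "Ck_sphere (Suc (length \<alpha>)) u" and w: "w \<in> sphere 0 1" for \<eta> \<xi> u w
  proof -
    have u: "Ck_sphere (length \<alpha>) u" using Ck_sphere_mono[OF h(2)] by simp
    have c: "continuous_on (sphere 0 1) (\<lambda>w. \<chi> i. pullback_expansion (i # \<alpha>) (D i) u \<eta> \<xi> w)"
      using D(1) h
      by (intro continuous_on_vec_lambda continuous_on_section[OF pullback_expansion_continuous])
         (simp_all del: Ck_sphere.simps)
    have "grad_S (grad_S_multi \<alpha> (\<lambda>w. u (pca_step \<eta> \<xi> w))) = grad_S (pullback_expansion \<alpha> E u \<eta> \<xi>)"
      by (rule grad_S_cong) (rule E(2)[OF h(1) u])
    then show ?thesis using grad_S_eqI[OF D(2)[OF h] c w] by simp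
  qed
  then show ?case
    by (intro exI[of _ "D i"] conjI allI impI ballI) (simp_all only: list.size add_0_right add_Suc_right D(1))
qed

lemma pca_step_Ck_sphere:
  fixes u :: "real ^ 'd \<Rightarrow> real"
  assumes u: "Ck_sphere k u" and "\<eta> \<ge> 0"
  shows "Ck_sphere k (\<lambda>w. u (pca_step \<eta> \<xi> w))"
  unfolding Ck_sphere_iff
proof (intro conjI allI impI)
  fix \<alpha> :: "'d list"
  obtain E where E: "remainder (length \<alpha>) E"
    "\<And>\<eta> \<xi> u w. \<eta> \<ge> 0 \<Longrightarrow> Ck_sphere (length \<alpha>) u \<Longrightarrow> w \<in> sphere 0 1 \<Longrightarrow>
       grad_S_multi \<alpha> (\<lambda>w. u (pca_step \<eta> \<xi> w)) w = pullback_expansion \<alpha> E u \<eta> \<xi> w"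
    using grad_S_multi_pca_step by blast
  show "\<exists>\<Psi> g. C1_extension (grad_S_multi \<alpha> (\<lambda>w. u (pca_step \<eta> \<xi> w))) \<Psi> g" if "length \<alpha> < k"
  proof -
    have h: "Ck_sphere (length \<alpha>) u" "Ck_sphere (Suc (length \<alpha>)) u"
      using Ck_sphere_mono[OF u] that by (simp_all del: Ck_sphere.simps)
    from pullback_expansion_grad[OF E(1)] obtain D
      where "\<forall>i. remainder (Suc (length \<alpha>)) (D i)"
      and "\<forall>\<eta> \<xi> u. \<eta> \<ge> 0 \<longrightarrow> Ck_sphere (Suc (length \<alpha>)) u \<longrightarrow>
        has_sphere_grad (pullback_expansion \<alpha> E u \<eta> \<xi>)
          (\<lambda>w. \<chi> i. pullback_expansion (i # \<alpha>) (D i) u \<eta> \<xi> w)"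
      by (elim exE conjE)
    note D = this[rule_format]
    have "has_sphere_grad (grad_S_multi \<alpha> (\<lambda>w. u (pca_step \<eta> \<xi> w)))
        (\<lambda>w. \<chi> i. pullback_expansion (i # \<alpha>) (D i) u \<eta> \<xi> w)"
      by (rule has_sphere_grad_transform[OF D(2)[OF \<open>\<eta> \<ge> 0\<close> h(2)] _ refl])
         (rule E(2)[OF \<open>\<eta> \<ge> 0\<close> h(1), symmetric])
    moreover have "continuous_on (sphere 0 1) (\<lambda>w. \<chi> i. pullback_expansion (i # \<alpha>) (D i) u \<eta> \<xi> w)"
      using D(1) h \<open>\<eta> \<ge> 0\<close>
      by (intro continuous_on_vec_lambda continuous_on_section[OF pullback_expansion_continuous])
         (simp_all del: Ck_sphere.simps)
    ultimately show ?thesis by (intro exI) (rule C1_extension_of_sphere_grad)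
  qed
  show "continuous_on (sphere 0 1) (grad_S_multi \<alpha> (\<lambda>w. u (pca_step \<eta> \<xi> w)))" if "length \<alpha> = k"
  proof -
    have h: "Ck_sphere (length \<alpha>) u" using u that by simp
    have "continuous_on (sphere 0 1) (pullback_expansion \<alpha> E u \<eta> \<xi>)"
      by (intro continuous_on_section[OF pullback_expansion_continuous] E(1) h \<open>\<eta> \<ge> 0\<close>)
    then show ?thesis
      by (simp only: E(2)[OF \<open>\<eta> \<ge> 0\<close> h] cong: continuous_on_cong)
  qed
qed

lemma grad_S_multi_pca_step_continuous:
  assumes "Ck_sphere k u" "length \<alpha> \<le> k" "\<eta> \<ge> 0"
  shows "continuous_on (UNIV \<times> sphere 0 1)
    (\<lambda>p. grad_S_multi \<alpha> (\<lambda>w. u (pca_step \<eta> (fst p) w)) (snd p))"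
proof -
  obtain E where E: "remainder (length \<alpha>) E"
    "\<And>\<eta> \<xi> u w. \<eta> \<ge> 0 \<Longrightarrow> Ck_sphere (length \<alpha>) u \<Longrightarrow> w \<in> sphere 0 1 \<Longrightarrow>
       grad_S_multi \<alpha> (\<lambda>w. u (pca_step \<eta> \<xi> w)) w = pullback_expansion \<alpha> E u \<eta> \<xi> w"
    using grad_S_multi_pca_step by blast
  have u: "Ck_sphere (length \<alpha>) u" using Ck_sphere_mono assms by blast
  have "continuous_on (UNIV \<times> sphere 0 1) (\<lambda>p. pullback_expansion \<alpha> E u \<eta> (fst p) (snd p))"
    by (rule pullback_expansion_continuous[OF E(1) u assms(3)])
  then show ?thesis
    by (rule continuous_on_eq) (use E(2)[OF assms(3) u] in \<open>simp add: mem_Times_iff\<close>)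
qed

section \<open>Differentiation under the expectation\<close>

lemma norm_expectation_le:
  fixes f :: "'a \<Rightarrow> 'b :: {banach, second_countable_topology}"
  assumes "prob_space M" "integrable M f" "AE x in M. norm (f x) \<le> c"
  shows "norm (LINT x|M. f x) \<le> c"
proof -
  interpret prob_space M by fact
  have "norm (LINT x|M. f x) \<le> (LINT x|M. norm (f x))" by (rule integral_norm_bound)
  also have "\<dots> \<le> (LINT x|M. c)"
    using assms by (intro integral_mono_AE) auto
  also have "\<dots> = c" by (simp add: prob_space)
  finally show ?thesis .
qed

text \<open>
  Samples are almost surely confined to the compact ball of radius \<open>R\<close>. Uniform continuity there replaces the domination
  hypotheses of the usual theorems on integrals with a parameter.
\<close>

lemma uniform_on_compact_fibres:
  fixes f :: "'a :: euclidean_space \<Rightarrow> 'b :: euclidean_space \<Rightarrow> 'c :: metric_space"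
  assumes "continuous_on (UNIV \<times> K) (\<lambda>p. f (fst p) (snd p))" "compact K" "e > 0"
  shows "\<exists>d>0. \<forall>\<xi> x y. norm \<xi> \<le> R \<and> x \<in> K \<and> y \<in> K \<and> dist y x < d \<longrightarrow> dist (f \<xi> y) (f \<xi> x) < e"
proof -
  let ?f = "\<lambda>p. f (fst p) (snd p)"
  have "uniformly_continuous_on (cball 0 R \<times> K) ?f"
    using assms by (intro compact_uniformly_continuous compact_Times)
      (auto elim: continuous_on_subset)
  then obtain d where d: "d > 0"
    "\<And>p q. p \<in> cball 0 R \<times> K \<Longrightarrow> q \<in> cball 0 R \<times> K \<Longrightarrow> dist q p < d \<Longrightarrow> dist (?f q) (?f p) < e"
    unfolding uniformly_continuous_on_def using \<open>e > 0\<close> by metis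
  have "dist (f \<xi> y) (f \<xi> x) < e" if "norm \<xi> \<le> R" "x \<in> K" "y \<in> K" "dist y x < d" for \<xi> x y
    using d(2)[of "(\<xi>, x)" "(\<xi>, y)"] that by (simp add: dist_Pair_Pair)
  then show ?thesis using d(1) by blast
qed

lemma integrable_continuous_parameter:
  fixes f :: "'a :: euclidean_space \<Rightarrow> 'b :: euclidean_space \<Rightarrow> 'c :: euclidean_space"
  assumes "prob_space \<nu>" and nu: "sets \<nu> = sets borel" and R: "AE \<xi> in \<nu>. norm \<xi> \<le> R"
    and f: "continuous_on (UNIV \<times> K) (\<lambda>p. f (fst p) (snd p))" and w: "w \<in> K"
  shows "integrable \<nu> (\<lambda>\<xi>. f \<xi> w)"
proof -
  interpret prob_space \<nu> by fact
  have c: "continuous_on UNIV (\<lambda>\<xi>. f \<xi> w)"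
  proof -
    have "continuous_on UNIV (\<lambda>\<xi>. (\<xi>, w))" by (intro continuous_intros)
    from continuous_on_compose2[OF f this] show ?thesis using w by auto
  qed
  have "compact ((\<lambda>\<xi>. f \<xi> w) ` cball 0 R)"
    by (intro compact_continuous_image continuous_on_subset[OF c]) auto
  then obtain B where B: "\<And>\<xi>. norm \<xi> \<le> R \<Longrightarrow> norm (f \<xi> w) \<le> B"
    using compact_imp_bounded[THEN bounded_iff[THEN iffD1]] by force
  have "(\<lambda>\<xi>. f \<xi> w) \<in> borel_measurable \<nu>"
    using borel_measurable_continuous_onI[OF c] measurable_cong_sets[OF nu refl] by blast
  then show ?thesis
    using R B by (intro integrable_const_bound[where B=B]) auto
qed

lemma continuous_expectation:
  fixes f :: "'a :: euclidean_space \<Rightarrow> 'b :: euclidean_space \<Rightarrow> 'c :: euclidean_space"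
  assumes nu: "prob_space \<nu>" "sets \<nu> = sets borel" "AE \<xi> in \<nu>. norm \<xi> \<le> R"
    and f: "continuous_on (UNIV \<times> K) (\<lambda>p. f (fst p) (snd p))" and K: "compact K"
  shows "continuous_on K (\<lambda>w. LINT \<xi>|\<nu>. f \<xi> w)"
  unfolding continuous_on_iff
proof (intro ballI allI impI)
  fix x e :: real and w assume w: "w \<in> K" and e: "e > (0 :: real)"
  obtain d where d: "d > 0"
    "\<And>\<xi> x y. norm \<xi> \<le> R \<Longrightarrow> x \<in> K \<Longrightarrow> y \<in> K \<Longrightarrow> dist y x < d \<Longrightarrow> dist (f \<xi> y) (f \<xi> x) < e / 2"
    using uniform_on_compact_fibres[OF f K, of "e / 2" R] e by auto
  note int = integrable_continuous_parameter[OF nu f]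
  have "dist (LINT \<xi>|\<nu>. f \<xi> y) (LINT \<xi>|\<nu>. f \<xi> w) < e" if y: "y \<in> K" "dist y w < d" for y
  proof -
    have "AE \<xi> in \<nu>. norm (f \<xi> y - f \<xi> w) \<le> e / 2"
      using nu(3) by eventually_elim (use d(2)[OF _ w y] in \<open>auto simp: dist_norm intro: less_imp_le\<close>)
    then have "norm (LINT \<xi>|\<nu>. f \<xi> y - f \<xi> w) \<le> e / 2"
      by (intro norm_expectation_le[OF nu(1)] Bochner_Integration.integrable_diff int y w)
    then show ?thesis using e by (simp add: dist_norm int y w)
  qed
  then show "\<exists>d>0. \<forall>y\<in>K. dist y w < d \<longrightarrow> dist (LINT \<xi>|\<nu>. f \<xi> y) (LINT \<xi>|\<nu>. f \<xi> w) < e"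
    using d(1) by blast
qed

text \<open>
  Near a point of the sphere the remainder of the first-order expansion of \<open>F \<xi>\<close> is at most \<open>e |y - w|\<close>, uniformly over
  \<open>|\<xi>| \<le> R\<close>, by the mean value inequality and the uniform continuity of the gradient. This bound
  survives integration over \<open>\<xi>\<close>.
\<close>

lemma expectation_sphere_grad:
  fixes F :: "real ^ 'd \<Rightarrow> real ^ 'd \<Rightarrow> real"
  assumes nu: "prob_space \<nu>" "sets \<nu> = sets borel" "AE \<xi> in \<nu>. norm \<xi> \<le> R"
    and grad: "\<And>\<xi>. has_sphere_grad (F \<xi>) (G \<xi>)"
    and F: "continuous_on (UNIV \<times> sphere 0 1) (\<lambda>p. F (fst p) (snd p))"
    and G: "continuous_on (UNIV \<times> sphere 0 1) (\<lambda>p. G (fst p) (snd p))"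
  shows "has_sphere_grad (\<lambda>w. LINT \<xi>|\<nu>. F \<xi> w) (\<lambda>w. LINT \<xi>|\<nu>. G \<xi> w)"
  unfolding has_sphere_grad_def
proof
  fix w :: "real ^ 'd" assume w: "w \<in> sphere 0 1"
  define f where "f \<xi> x = F \<xi> (sgn x)" for \<xi> x
  define g where "g \<xi> x = G \<xi> (sgn x) /\<^sub>R norm x" for \<xi> x
  \<comment> \<open>radius \<open>1/2\<close> keeps the ball away from the origin, where \<open>sgn\<close> is not differentiable\<close>
  let ?K = "cball w (1/2)"
  have nz: "x \<noteq> 0" if "x \<in> ?K" for x using that w by (auto simp: dist_norm)
  have wK: "w \<in> ?K" by simp
  have sgnK: "continuous_on (UNIV \<times> ?K) (\<lambda>p :: (real ^ 'd) \<times> (real ^ 'd). (fst p, sgn (snd p)))"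
    using nz by (intro continuous_intros) auto
  have im: "(\<lambda>p :: (real ^ 'd) \<times> (real ^ 'd). (fst p, sgn (snd p))) ` (UNIV \<times> ?K) \<subseteq> UNIV \<times> sphere 0 1"
    by (rule image_subsetI) (use sgn_in_sphere[OF nz] in \<open>simp add: mem_Times_iff del: mem_sphere_0\<close>)
  have cf: "continuous_on (UNIV \<times> ?K) (\<lambda>p. f (fst p) (snd p))"
    using continuous_on_compose2[OF F sgnK im] by (simp add: f_def)
  have "continuous_on (UNIV \<times> ?K) (\<lambda>p. G (fst p) (sgn (snd p)))"
    using continuous_on_compose2[OF G sgnK im] by simp
  then have cg: "continuous_on (UNIV \<times> ?K) (\<lambda>p. g (fst p) (snd p))"
    unfolding g_def using nz by (intro continuous_intros) auto
  note intf = integrable_continuous_parameter[OF nu cf]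
  note intg = integrable_continuous_parameter[OF nu cg]
  have D: "(f \<xi> has_derivative (\<lambda>h. h \<bullet> g \<xi> x)) (at x within S)" if "x \<in> ?K" for \<xi> x S
    using has_sphere_grad_GDERIV[OF grad nz[OF that]]
    unfolding f_def[abs_def] g_def gderiv_def by (rule has_derivative_at_withinI)
  have "((\<lambda>x. LINT \<xi>|\<nu>. f \<xi> x) has_derivative (\<lambda>h. h \<bullet> (LINT \<xi>|\<nu>. g \<xi> w))) (at w)"
    unfolding has_derivative_at_alt
  proof (intro conjI allI impI)
    show "bounded_linear (\<lambda>h. h \<bullet> (LINT \<xi>|\<nu>. g \<xi> w))" by (rule bounded_linear_inner_left)
    fix e :: real assume e: "e > 0"
    obtain d where d: "d > 0"
      "\<And>\<xi> x y. norm \<xi> \<le> R \<Longrightarrow> x \<in> ?K \<Longrightarrow> y \<in> ?K \<Longrightarrow> dist y x < d \<Longrightarrow> dist (g \<xi> y) (g \<xi> x) < e"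
      using uniform_on_compact_fibres[OF cg compact_cball e, of R] by blast
    define r where "r = min d (1/2)"
    have r: "r > 0" using d(1) by (simp add: r_def)
    have "norm ((LINT \<xi>|\<nu>. f \<xi> y) - (LINT \<xi>|\<nu>. f \<xi> w) - (y - w) \<bullet> (LINT \<xi>|\<nu>. g \<xi> w)) \<le> e * norm (y - w)"
      if y: "norm (y - w) < r" for y
    proof -
      have yK: "y \<in> ?K" using y by (simp add: r_def dist_norm norm_minus_commute)
      have b: "norm (f \<xi> y - f \<xi> w - (y - w) \<bullet> g \<xi> w) \<le> e * norm (y - w)" if xi: "norm \<xi> \<le> R" for \<xi>
      proof -
        let ?S = "ball w r"
        have SK: "?S \<subseteq> ?K" by (auto simp: r_def)
        have "norm (f \<xi> y - f \<xi> w - (y - w) \<bullet> g \<xi> w) \<le> norm (y - w) * e"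
        proof (rule differentiable_bound_linearization[where S="?S" and f'="\<lambda>x h. h \<bullet> g \<xi> x"])
          show "w + t *\<^sub>R (y - w) \<in> ?S" if "t \<in> {0..1}" for t
          proof -
            have "norm (t *\<^sub>R (y - w)) \<le> 1 * norm (y - w)"
              unfolding norm_scaleR using that by (intro mult_right_mono) auto
            then show ?thesis using y by (simp add: dist_norm)
          qed
          show "(f \<xi> has_derivative (\<lambda>h. h \<bullet> g \<xi> x)) (at x within ?S)" if "x \<in> ?S" for x
            using D that SK by blast
          show "onorm ((\<lambda>h. h \<bullet> g \<xi> x) - (\<lambda>h. h \<bullet> g \<xi> w)) \<le> e" if x: "x \<in> ?S" for x
          proof (rule onorm_bound)
            have "dist (g \<xi> x) (g \<xi> w) < e"
              using x SK by (intro d(2) xi wK) (auto simp: r_def dist_commute)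
            then have n: "norm (g \<xi> x - g \<xi> w) \<le> e" by (simp add: dist_norm)
            show "norm (((\<lambda>h. h \<bullet> g \<xi> x) - (\<lambda>h. h \<bullet> g \<xi> w)) h) \<le> e * norm h" for h
            proof -
              have "\<bar>h \<bullet> (g \<xi> x - g \<xi> w)\<bar> \<le> norm h * norm (g \<xi> x - g \<xi> w)"
                by (rule Cauchy_Schwarz_ineq2)
              also have "\<dots> \<le> norm h * e" using n by (intro mult_left_mono) auto
              finally show ?thesis by (simp add: inner_diff_right mult.commute)
            qed
          qed (use e in auto)
          show "w \<in> ?S" using r by simp
        qed
        then show ?thesis by (simp add: mult.commute)
      qed
      have "AE \<xi> in \<nu>. norm (f \<xi> y - f \<xi> w - (y - w) \<bullet> g \<xi> w) \<le> e * norm (y - w)"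
        using nu(3) by eventually_elim (rule b)
      then have "norm (LINT \<xi>|\<nu>. f \<xi> y - f \<xi> w - (y - w) \<bullet> g \<xi> w) \<le> e * norm (y - w)"
        by (intro norm_expectation_le[OF nu(1)] Bochner_Integration.integrable_diff
            integrable_inner_right intf intg yK wK)
      moreover have "(LINT \<xi>|\<nu>. f \<xi> y - f \<xi> w - (y - w) \<bullet> g \<xi> w) =
          (LINT \<xi>|\<nu>. f \<xi> y) - (LINT \<xi>|\<nu>. f \<xi> w) - (y - w) \<bullet> (LINT \<xi>|\<nu>. g \<xi> w)"
        using intf[OF yK] intf[OF wK] intg[OF wK] by simp
      ultimately show ?thesis by simp
    qed
    then show "\<exists>d>0. \<forall>y. norm (y - w) < d \<longrightarrow>
        norm ((LINT \<xi>|\<nu>. f \<xi> y) - (LINT \<xi>|\<nu>. f \<xi> w) - (y - w) \<bullet> (LINT \<xi>|\<nu>. g \<xi> w)) \<le> e * norm (y - w)"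
      using r by blast
  qed
  then show "GDERIV (\<lambda>x. LINT \<xi>|\<nu>. F \<xi> (sgn x)) w :> (LINT \<xi>|\<nu>. G \<xi> w)"
    using w sgn_sphere[OF w] by (simp add: gderiv_def f_def g_def)
qed

text \<open>
  Induction on \<open>\<alpha>\<close>, differentiating under the expectation once per step; the gradients are jointly
  continuous in the sample and the point because the expansion of \<open>grad_S_multi_pca_step\<close> is.
\<close>

lemma grad_S_multi_pca_S:
  fixes u :: "real ^ 'd \<Rightarrow> real"
  assumes nu: "prob_space \<nu>" "sets \<nu> = sets borel" "AE \<xi> in \<nu>. norm \<xi> \<le> R"
    and u: "Ck_sphere k u" and "\<eta> \<ge> 0"
  shows "length \<alpha> \<le> k \<Longrightarrow> w \<in> sphere 0 1 \<Longrightarrow>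
      grad_S_multi \<alpha> (pca_S \<nu> \<eta> u) w = (LINT \<xi>|\<nu>. grad_S_multi \<alpha> (\<lambda>w. u (pca_step \<eta> \<xi> w)) w)"
    and "length \<alpha> < k \<Longrightarrow> has_sphere_grad (grad_S_multi \<alpha> (pca_S \<nu> \<eta> u))
      (\<lambda>w. LINT \<xi>|\<nu>. grad_S (grad_S_multi \<alpha> (\<lambda>w. u (pca_step \<eta> \<xi> w))) w)"
    and "length \<alpha> < k \<Longrightarrow> continuous_on (sphere 0 1)
      (\<lambda>w. LINT \<xi>|\<nu>. grad_S (grad_S_multi \<alpha> (\<lambda>w. u (pca_step \<eta> \<xi> w))) w)"
proof -
  let ?v = "\<lambda>\<xi> w. u (pca_step \<eta> \<xi> w)"
  have grad_cont: "continuous_on (UNIV \<times> sphere 0 1)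
      (\<lambda>p. grad_S (grad_S_multi \<alpha> (?v (fst p))) (snd p))" if "length \<alpha> < k" for \<alpha>
  proof -
    have "continuous_on (UNIV \<times> sphere 0 1) (\<lambda>p. \<chi> i. grad_S_multi (i # \<alpha>) (?v (fst p)) (snd p))"
      using that by (intro continuous_on_vec_lambda grad_S_multi_pca_step_continuous[OF u] \<open>\<eta> \<ge> 0\<close>) simp
    then show ?thesis by simp
  qed
  have cont: "continuous_on (sphere 0 1) (\<lambda>w. LINT \<xi>|\<nu>. grad_S (grad_S_multi \<alpha> (?v \<xi>)) w)"
    if "length \<alpha> < k" for \<alpha>
    by (rule continuous_expectation[OF nu grad_cont[OF that] compact_sphere])
  have grad: "has_sphere_grad (\<lambda>w. LINT \<xi>|\<nu>. grad_S_multi \<alpha> (?v \<xi>) w)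
      (\<lambda>w. LINT \<xi>|\<nu>. grad_S (grad_S_multi \<alpha> (?v \<xi>)) w)" if "length \<alpha> < k" for \<alpha>
    using that
    by (intro expectation_sphere_grad[OF nu] grad_cont grad_S_multi_pca_step_continuous[OF u]
        Ck_sphere_grad(2)[OF pca_step_Ck_sphere[OF u]] \<open>\<eta> \<ge> 0\<close>) simp_all
  have eq: "length \<alpha> \<le> k \<Longrightarrow> w \<in> sphere 0 1 \<Longrightarrow>
      grad_S_multi \<alpha> (pca_S \<nu> \<eta> u) w = (LINT \<xi>|\<nu>. grad_S_multi \<alpha> (?v \<xi>) w)" for \<alpha> w
  proof (induction \<alpha> arbitrary: w)
    case Nil show ?case by (simp add: pca_S_def)
  next
    case (Cons i \<alpha>)
    have l: "length \<alpha> < k" using Cons.prems by simp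
    have "grad_S (grad_S_multi \<alpha> (pca_S \<nu> \<eta> u)) = grad_S (\<lambda>w. LINT \<xi>|\<nu>. grad_S_multi \<alpha> (?v \<xi>) w)"
      by (rule grad_S_cong) (rule Cons.IH[OF less_imp_le[OF l]])
    then have "grad_S (grad_S_multi \<alpha> (pca_S \<nu> \<eta> u)) w = (LINT \<xi>|\<nu>. grad_S (grad_S_multi \<alpha> (?v \<xi>)) w)"
      using grad_S_eqI[OF grad[OF l] cont[OF l] Cons.prems(2)] by simp
    then show ?case
      using integral_bounded_linear[OF bounded_linear_vec_nth
          integrable_continuous_parameter[OF nu grad_cont[OF l] Cons.prems(2)], of i]
      by simp
  qed
  show "length \<alpha> \<le> k \<Longrightarrow> w \<in> sphere 0 1 \<Longrightarrow>
      grad_S_multi \<alpha> (pca_S \<nu> \<eta> u) w = (LINT \<xi>|\<nu>. grad_S_multi \<alpha> (?v \<xi>) w)"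
    by (rule eq)
  show "continuous_on (sphere 0 1) (\<lambda>w. LINT \<xi>|\<nu>. grad_S (grad_S_multi \<alpha> (?v \<xi>)) w)" if "length \<alpha> < k"
    by (rule cont[OF that])
  show "has_sphere_grad (grad_S_multi \<alpha> (pca_S \<nu> \<eta> u))
      (\<lambda>w. LINT \<xi>|\<nu>. grad_S (grad_S_multi \<alpha> (?v \<xi>)) w)" if "length \<alpha> < k"
    by (rule has_sphere_grad_transform[OF grad[OF that] _ refl])
       (rule eq[OF less_imp_le[OF that], symmetric])
qed

lemma pca_S_Ck_sphere:
  fixes u :: "real ^ 'd \<Rightarrow> real"
  assumes nu: "prob_space \<nu>" "sets \<nu> = sets borel" "AE \<xi> in \<nu>. norm \<xi> \<le> R"
    and u: "Ck_sphere k u" and "\<eta> \<ge> 0"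
  shows "Ck_sphere k (pca_S \<nu> \<eta> u)"
  unfolding Ck_sphere_iff
proof (intro conjI allI impI)
  fix \<alpha> :: "'d list"
  note S = grad_S_multi_pca_S[OF nu u \<open>\<eta> \<ge> 0\<close>]
  show "\<exists>\<Psi> g. C1_extension (grad_S_multi \<alpha> (pca_S \<nu> \<eta> u)) \<Psi> g" if "length \<alpha> < k"
    using C1_extension_of_sphere_grad[OF S(2)[OF that] S(3)[OF that]] by blast
  show "continuous_on (sphere 0 1) (grad_S_multi \<alpha> (pca_S \<nu> \<eta> u))" if "length \<alpha> = k"
  proof -
    have l: "length \<alpha> \<le> k" using that by simp
    have "continuous_on (sphere 0 1) (\<lambda>w. LINT \<xi>|\<nu>. grad_S_multi \<alpha> (\<lambda>w. u (pca_step \<eta> \<xi> w)) w)"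
      by (rule continuous_expectation[OF nu grad_S_multi_pca_step_continuous[OF u l \<open>\<eta> \<ge> 0\<close>] compact_sphere])
    then show ?thesis by (simp only: S(1)[OF l] cong: continuous_on_cong)
  qed
qed

section \<open>Stability of the smoothness norm\<close>

lemma sphere_nonempty: "(sphere 0 1 :: (real ^ 'd) set) \<noteq> {}"
proof -
  have "axis undefined 1 \<in> (sphere 0 1 :: (real ^ 'd) set)" by simp
  then show ?thesis by blast
qed

definition sup_norm :: "(real ^ 'd \<Rightarrow> real) \<Rightarrow> real" where
  "sup_norm f = (SUP w\<in>sphere 0 1. \<bar>f w\<bar>)"

lemma le_sup_norm:
  fixes f :: "real ^ 'd \<Rightarrow> real"
  assumes "continuous_on (sphere 0 1) f" "w \<in> sphere 0 1"
  shows "\<bar>f w\<bar> \<le> sup_norm f"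
proof -
  have "compact ((\<lambda>w. \<bar>f w\<bar>) ` sphere 0 1)"
    by (intro compact_continuous_image continuous_intros assms compact_sphere)
  then have "bdd_above ((\<lambda>w. \<bar>f w\<bar>) ` sphere 0 1)"
    by (intro bounded_imp_bdd_above compact_imp_bounded)
  then show ?thesis unfolding sup_norm_def using assms(2) by (intro cSUP_upper)
qed

lemma sup_norm_le: "(\<And>w. w \<in> sphere 0 1 \<Longrightarrow> \<bar>f w\<bar> \<le> c) \<Longrightarrow> sup_norm f \<le> c"
  unfolding sup_norm_def by (intro cSUP_least sphere_nonempty)

lemma sup_norm_nonneg:
  fixes f :: "real ^ 'd \<Rightarrow> real"
  assumes "continuous_on (sphere 0 1) f"
  shows "0 \<le> sup_norm f"
proof -
  obtain w :: "real ^ 'd" where "w \<in> sphere 0 1" using sphere_nonempty by blast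
  from le_sup_norm[OF assms this] show ?thesis by (rule order_trans[OF abs_ge_zero])
qed

lemma finite_multi_indices: "finite {\<alpha> :: 'd :: finite list. length \<alpha> \<le> k}"
  using finite_lists_length_le[of "UNIV :: 'd set" k] by simp

lemma Ck_norm_eq: "Ck_norm k u = (\<Sum>\<alpha> | length \<alpha> \<le> k. sup_norm (grad_S_multi \<alpha> u))"
  by (simp add: Ck_norm_def sup_norm_def)

lemma sup_norm_le_Ck_norm:
  assumes "Ck_sphere k u" "length \<beta> \<le> k"
  shows "sup_norm (grad_S_multi \<beta> u) \<le> Ck_norm k u"
  unfolding Ck_norm_eq
  using assms Ck_sphere_continuous[OF assms(1)]
  by (intro member_le_sum finite_multi_indices) (auto intro: sup_norm_nonneg)

lemma Ck_norm_nonneg: "Ck_sphere k u \<Longrightarrow> 0 \<le> Ck_norm k u"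
  unfolding Ck_norm_eq by (intro sum_nonneg) (auto intro: sup_norm_nonneg Ck_sphere_continuous)

text \<open>
  The step maps the sphere to itself, so derivatives at the image point are still controlled by the norm of \<open>u\<close>.
\<close>

lemma remainder_bounded:
  assumes "remainder m E" "m \<le> k" "R \<ge> 0"
  shows "\<exists>K\<ge>0. \<forall>\<eta> \<xi> w u. 0 \<le> \<eta> \<and> \<eta> \<le> 1 \<and> norm \<xi> \<le> R \<and> w \<in> sphere 0 1 \<and> Ck_sphere k u \<longrightarrow>
    \<bar>E u \<eta> \<xi> w\<bar> \<le> K * Ck_norm k u"
  using assms(1)
proof induction
  case (remainder_term b \<beta>)
  obtain K where K: "K \<ge> 0"
    "\<And>\<eta> \<xi> w. 0 \<le> \<eta> \<Longrightarrow> \<eta> \<le> 1 \<Longrightarrow> norm \<xi> \<le> R \<Longrightarrow> w \<in> sphere 0 1 \<Longrightarrow> \<bar>b \<eta> \<xi> w\<bar> \<le> K"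
    using coef_bounded[OF \<open>coef b\<close> \<open>R \<ge> 0\<close>] by blast
  have "\<bar>b \<eta> \<xi> w * grad_S_multi \<beta> u (pca_step \<eta> \<xi> w)\<bar> \<le> K * Ck_norm k u"
    if h: "0 \<le> \<eta>" "\<eta> \<le> 1" "norm \<xi> \<le> R" "w \<in> sphere 0 1" "Ck_sphere k u" for \<eta> \<xi> w u
  proof -
    have l: "length \<beta> \<le> k" using remainder_term assms(2) by simp
    have "\<bar>grad_S_multi \<beta> u (pca_step \<eta> \<xi> w)\<bar> \<le> Ck_norm k u"
      using le_sup_norm[OF Ck_sphere_continuous[OF h(5) l] pca_step_sphere[OF h(1,4)]]
        sup_norm_le_Ck_norm[OF h(5) l] by (rule order_trans)
    then show ?thesis unfolding abs_mult using K(1) K(2)[OF h(1-4)] by (intro mult_mono) auto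
  qed
  then show ?case using K(1) by blast
next
  case (remainder_add E F)
  then obtain K L where K: "K \<ge> 0" "\<And>\<eta> \<xi> w u. 0 \<le> \<eta> \<Longrightarrow> \<eta> \<le> 1 \<Longrightarrow> norm \<xi> \<le> R \<Longrightarrow>
        w \<in> sphere 0 1 \<Longrightarrow> Ck_sphere k u \<Longrightarrow> \<bar>E u \<eta> \<xi> w\<bar> \<le> K * Ck_norm k u"
    and L: "L \<ge> 0" "\<And>\<eta> \<xi> w u. 0 \<le> \<eta> \<Longrightarrow> \<eta> \<le> 1 \<Longrightarrow> norm \<xi> \<le> R \<Longrightarrow>
        w \<in> sphere 0 1 \<Longrightarrow> Ck_sphere k u \<Longrightarrow> \<bar>F u \<eta> \<xi> w\<bar> \<le> L * Ck_norm k u"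
    by blast
  have "\<bar>E u \<eta> \<xi> w + F u \<eta> \<xi> w\<bar> \<le> (K + L) * Ck_norm k u"
    if "0 \<le> \<eta>" "\<eta> \<le> 1" "norm \<xi> \<le> R" "w \<in> sphere 0 1" "Ck_sphere k u" for \<eta> \<xi> w u
    using abs_triangle_ineq[of "E u \<eta> \<xi> w" "F u \<eta> \<xi> w"] K(2)[OF that] L(2)[OF that]
    by (simp add: distrib_right)
  moreover have "K + L \<ge> 0" using K(1) L(1) by simp
  ultimately show ?case by blast
qed

text \<open>
  The leading term keeps the constant \<open>1\<close> because \<open>r \<le> 1\<close>; a constant above \<open>1\<close> that does not tend to \<open>1\<close>
  with \<open>\<eta>\<close> would grow exponentially over the \<open>n \<approx> T / \<eta>\<close> steps.
\<close>

lemma sup_norm_grad_S_multi_pca_S_le: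
  fixes \<nu> :: "(real ^ 'd) measure" and \<alpha> :: "'d list"
  assumes nu: "prob_space \<nu>" "sets \<nu> = sets borel" "AE \<xi> in \<nu>. norm \<xi> \<le> R"
    and "R \<ge> 0" and l: "length \<alpha> \<le> k"
  shows "\<exists>K\<ge>0. \<forall>\<eta> u. 0 \<le> \<eta> \<and> \<eta> \<le> 1 \<and> Ck_sphere k u \<longrightarrow>
    sup_norm (grad_S_multi \<alpha> (pca_S \<nu> \<eta> u)) \<le> sup_norm (grad_S_multi \<alpha> u) + K * \<eta> * Ck_norm k u"
proof -
  from grad_S_multi_pca_step[of \<alpha>] obtain E where
    E: "remainder (length \<alpha>) E" and ex: "\<forall>\<eta> \<xi> u. \<eta> \<ge> 0 \<longrightarrow> Ck_sphere (length \<alpha>) u \<longrightarrow>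
      (\<forall>w\<in>sphere 0 1. grad_S_multi \<alpha> (\<lambda>w. u (pca_step \<eta> \<xi> w)) w = pullback_expansion \<alpha> E u \<eta> \<xi> w)"
    by (elim exE conjE)
  obtain K where K: "K \<ge> 0" "\<And>\<eta> \<xi> w u. 0 \<le> \<eta> \<Longrightarrow> \<eta> \<le> 1 \<Longrightarrow> norm \<xi> \<le> R \<Longrightarrow>
      w \<in> sphere 0 1 \<Longrightarrow> Ck_sphere k u \<Longrightarrow> \<bar>E u \<eta> \<xi> w\<bar> \<le> K * Ck_norm k u"
    using remainder_bounded[OF E l \<open>R \<ge> 0\<close>] by blast
  have "sup_norm (grad_S_multi \<alpha> (pca_S \<nu> \<eta> u)) \<le> sup_norm (grad_S_multi \<alpha> u) + K * \<eta> * Ck_norm k u"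
    if h: "0 \<le> \<eta>" "\<eta> \<le> 1" and u: "Ck_sphere k u" for \<eta> u
  proof (rule sup_norm_le)
    fix w :: "real ^ 'd" assume w: "w \<in> sphere 0 1"
    have ul: "Ck_sphere (length \<alpha>) u" by (rule Ck_sphere_mono[OF u l])
    have "\<bar>grad_S_multi \<alpha> (\<lambda>w. u (pca_step \<eta> \<xi> w)) w\<bar> \<le>
        sup_norm (grad_S_multi \<alpha> u) + K * \<eta> * Ck_norm k u" if xi: "norm \<xi> \<le> R" for \<xi>
    proof -
      let ?s = "shrink \<eta> \<xi> w ^ length \<alpha>" and ?g = "grad_S_multi \<alpha> u (pca_step \<eta> \<xi> w)"
      have s: "0 \<le> ?s" "?s \<le> 1"
        using shrink_bounds[OF h(1) w, of \<xi>] by (simp_all add: power_le_one)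
      have "\<bar>?s * ?g\<bar> \<le> 1 * \<bar>?g\<bar>" unfolding abs_mult using s by (intro mult_right_mono) auto
      also have "\<dots> \<le> sup_norm (grad_S_multi \<alpha> u)"
        using le_sup_norm[OF Ck_sphere_continuous[OF u l] pca_step_sphere[OF h(1) w]] by simp
      finally have "\<bar>?s * ?g\<bar> \<le> sup_norm (grad_S_multi \<alpha> u)" .
      moreover have "\<bar>\<eta> * E u \<eta> \<xi> w\<bar> \<le> \<eta> * (K * Ck_norm k u)"
        unfolding abs_mult using h(1) K(2)[OF h xi w u] by (intro mult_mono) auto
      ultimately show ?thesis
        using ex[rule_format, OF h(1) ul w] abs_triangle_ineq[of "?s * ?g" "\<eta> * E u \<eta> \<xi> w"]
        by (simp add: pullback_expansion_def mult_ac)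
    qed
    then have "AE \<xi> in \<nu>. norm (grad_S_multi \<alpha> (\<lambda>w. u (pca_step \<eta> \<xi> w)) w) \<le>
        sup_norm (grad_S_multi \<alpha> u) + K * \<eta> * Ck_norm k u"
      using nu(3) by (auto elim: eventually_mono)
    from norm_expectation_le[OF nu(1) integrable_continuous_parameter[OF nu
          grad_S_multi_pca_step_continuous[OF u l h(1)] w] this]
    show "\<bar>grad_S_multi \<alpha> (pca_S \<nu> \<eta> u) w\<bar> \<le> sup_norm (grad_S_multi \<alpha> u) + K * \<eta> * Ck_norm k u"
      unfolding grad_S_multi_pca_S(1)[OF nu u h(1) l w] real_norm_def .
  qed
  then show ?thesis using K(1) by blast
qed

lemma Ck_norm_pca_S_le:
  fixes \<nu> :: "(real ^ 'd) measure"
  assumes nu: "prob_space \<nu>" "sets \<nu> = sets borel" "AE \<xi> in \<nu>. norm \<xi> \<le> R"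
    and "R \<ge> 0"
  shows "\<exists>K\<ge>0. \<forall>\<eta> u. 0 \<le> \<eta> \<and> \<eta> \<le> 1 \<and> Ck_sphere k u \<longrightarrow>
    Ck_norm k (pca_S \<nu> \<eta> u) \<le> (1 + K * \<eta>) * Ck_norm k u"
proof -
  let ?A = "{\<alpha> :: 'd list. length \<alpha> \<le> k}"
  have "\<forall>\<alpha>\<in>?A. \<exists>K\<ge>0. \<forall>\<eta> u. 0 \<le> \<eta> \<and> \<eta> \<le> 1 \<and> Ck_sphere k u \<longrightarrow>
      sup_norm (grad_S_multi \<alpha> (pca_S \<nu> \<eta> u)) \<le> sup_norm (grad_S_multi \<alpha> u) + K * \<eta> * Ck_norm k u"
    using sup_norm_grad_S_multi_pca_S_le[OF nu \<open>R \<ge> 0\<close>] by simp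
  from bchoice[OF this] obtain K where K: "\<forall>\<alpha>\<in>?A. K \<alpha> \<ge> 0 \<and> (\<forall>\<eta> u. 0 \<le> \<eta> \<and> \<eta> \<le> 1 \<and> Ck_sphere k u \<longrightarrow>
      sup_norm (grad_S_multi \<alpha> (pca_S \<nu> \<eta> u)) \<le> sup_norm (grad_S_multi \<alpha> u) + K \<alpha> * \<eta> * Ck_norm k u)"
    by (elim exE)
  have "Ck_norm k (pca_S \<nu> \<eta> u) \<le> (1 + (\<Sum>\<alpha>\<in>?A. K \<alpha>) * \<eta>) * Ck_norm k u"
    if "0 \<le> \<eta>" "\<eta> \<le> 1" "Ck_sphere k u" for \<eta> u
  proof -
    have "Ck_norm k (pca_S \<nu> \<eta> u) \<le> (\<Sum>\<alpha>\<in>?A. sup_norm (grad_S_multi \<alpha> u) + K \<alpha> * \<eta> * Ck_norm k u)"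
      unfolding Ck_norm_eq[of k "pca_S \<nu> \<eta> u"] using K that by (intro sum_mono) blast
    also have "\<dots> = (1 + (\<Sum>\<alpha>\<in>?A. K \<alpha>) * \<eta>) * Ck_norm k u"
      by (simp add: sum.distrib Ck_norm_eq[symmetric] sum_distrib_right distrib_right)
    finally show ?thesis .
  qed
  moreover have "(\<Sum>\<alpha>\<in>?A. K \<alpha>) \<ge> 0" using K by (intro sum_nonneg) blast
  ultimately show ?thesis by blast
qed

text \<open>
  By the Markov property, \<open>pca_u\<close> after \<open>n + 1\<close> steps is \<open>S\<close> applied to \<open>pca_u\<close> after \<open>n\<close> steps, at least on the
  sphere, which is where smoothness and norm are read off.
\<close>

lemma pca_u_stable:
  fixes \<nu> :: "(real ^ 'd) measure"
  assumes nu: "prob_space \<nu>" "sets \<nu> = sets borel" "AE \<xi> in \<nu>. norm \<xi> \<le> R"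
    and phi: "Ck_sphere k \<phi>" and eta: "0 < \<eta>" "\<eta> \<le> 1"
    and K: "K \<ge> 0" "\<And>\<eta> u. 0 \<le> \<eta> \<Longrightarrow> \<eta> \<le> 1 \<Longrightarrow> Ck_sphere k u \<Longrightarrow>
      Ck_norm k (pca_S \<nu> \<eta> u) \<le> (1 + K * \<eta>) * Ck_norm k u"
  shows "Ck_sphere k (pca_u \<nu> \<eta> \<phi> n) \<and> Ck_norm k (pca_u \<nu> \<eta> \<phi> n) \<le> (1 + K * \<eta>) ^ n * Ck_norm k \<phi>"
proof (induction n)
  case 0
  have e: "pca_u \<nu> \<eta> \<phi> 0 w = \<phi> w" for w by (rule pca_u_0[OF nu(1)])
  show ?case using Ck_sphere_cong[of "pca_u \<nu> \<eta> \<phi> 0" \<phi>, OF e] Ck_norm_cong[of "pca_u \<nu> \<eta> \<phi> 0" \<phi>, OF e] phi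
    by simp
next
  case (Suc n)
  let ?u = "pca_u \<nu> \<eta> \<phi> n"
  have c: "continuous_on (sphere 0 1) \<phi>" using Ck_sphere_continuous[OF phi, of "[]"] by simp
  have e: "pca_u \<nu> \<eta> \<phi> (Suc n) w = pca_S \<nu> \<eta> ?u w" if "w \<in> sphere 0 1" for w
    by (rule pca_u_Suc[OF nu(1,2) eta(1) borel_measurable_continuous_on_restrict[OF c] le_sup_norm[OF c] that])
  have "Ck_norm k (pca_S \<nu> \<eta> ?u) \<le> (1 + K * \<eta>) * Ck_norm k ?u"
    using K(2) eta Suc by simp
  also have "\<dots> \<le> (1 + K * \<eta>) * ((1 + K * \<eta>) ^ n * Ck_norm k \<phi>)"
    using K(1) eta Suc by (intro mult_left_mono) simp_all
  finally have "Ck_norm k (pca_S \<nu> \<eta> ?u) \<le> (1 + K * \<eta>) ^ Suc n * Ck_norm k \<phi>" by simp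
  moreover have "Ck_sphere k (pca_S \<nu> \<eta> ?u)"
    using pca_S_Ck_sphere[OF nu] Suc eta by simp
  moreover have "Ck_sphere k (pca_u \<nu> \<eta> \<phi> (Suc n)) \<longleftrightarrow> Ck_sphere k (pca_S \<nu> \<eta> ?u)"
    by (rule Ck_sphere_cong) (rule e)
  moreover have "Ck_norm k (pca_u \<nu> \<eta> \<phi> (Suc n)) = Ck_norm k (pca_S \<nu> \<eta> ?u)"
    by (rule Ck_norm_cong) (rule e)
  ultimately show ?case by simp
qed

text \<open>
  Here \<open>(1 + K \<eta>)\<^sup>n \<le> exp (K n \<eta>) \<le> exp (K T)\<close>, and \<open>K\<close> was obtained before \<open>\<eta>\<close>, \<open>n\<close> and \<open>\<phi>\<close> were chosen.
\<close>

lemma pca_u_Ck_bound: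
  fixes \<nu> :: "(real ^ 'd) measure"
  assumes nu: "prob_space \<nu>" "sets \<nu> = sets borel" "AE \<xi> in \<nu>. norm \<xi> \<le> R" and "R \<ge> 0"
  shows "\<exists>C. \<forall>\<phi>. Ck_sphere k \<phi> \<longrightarrow>
    (\<forall>\<eta> n. 0 < \<eta> \<and> \<eta> \<le> 1 \<and> real n * \<eta> \<le> T \<longrightarrow>
       Ck_sphere k (pca_u \<nu> \<eta> \<phi> n) \<and> Ck_norm k (pca_u \<nu> \<eta> \<phi> n) \<le> C * Ck_norm k \<phi>)"
proof -
  obtain K where K: "K \<ge> 0" "\<And>\<eta> u. 0 \<le> \<eta> \<Longrightarrow> \<eta> \<le> 1 \<Longrightarrow> Ck_sphere k u \<Longrightarrow>
      Ck_norm k (pca_S \<nu> \<eta> u) \<le> (1 + K * \<eta>) * Ck_norm k u"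
    using Ck_norm_pca_S_le[OF nu \<open>R \<ge> 0\<close>, of k] by blast
  have "Ck_norm k (pca_u \<nu> \<eta> \<phi> n) \<le> exp (K * T) * Ck_norm k \<phi>"
    if phi: "Ck_sphere k \<phi>" and eta: "0 < \<eta>" "\<eta> \<le> 1" and n: "real n * \<eta> \<le> T" for \<phi> \<eta> n
  proof -
    have "(1 + K * \<eta>) ^ n \<le> exp (K * \<eta>) ^ n"
      using K(1) eta by (intro power_mono exp_ge_add_one_self) simp_all
    also have "\<dots> = exp (K * (real n * \<eta>))" by (simp add: exp_of_nat_mult[symmetric] mult_ac)
    also have "\<dots> \<le> exp (K * T)" using K(1) n by (simp add: mult_left_mono)
    finally have "(1 + K * \<eta>) ^ n * Ck_norm k \<phi> \<le> exp (K * T) * Ck_norm k \<phi>"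
      by (intro mult_right_mono Ck_norm_nonneg phi)
    then show ?thesis using pca_u_stable[OF nu phi eta K, of n] by simp
  qed
  moreover have "Ck_sphere k (pca_u \<nu> \<eta> \<phi> n)" if "Ck_sphere k \<phi>" "0 < \<eta>" "\<eta> \<le> 1" for \<phi> \<eta> n
    using pca_u_stable[OF nu that K] by blast
  ultimately show ?thesis by blast
qed

section \<open>Null sets and the action on classes of functions\<close>

lemma space_sphere_measure: "space sphere_measure = (sphere 0 1 :: (real ^ 'd) set)"
  by (simp add: sphere_measure_def space_scale_measure space_restrict_space)

lemma sets_sphere_measure:
  "sets sphere_measure = sets (restrict_space borel (sphere 0 1 :: (real ^ 'd) set))"
  by (simp add: sphere_measure_def)

lemma finite_sphere_measure: "finite_measure (sphere_measure :: (real ^ 'd) measure)"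
proof (rule finite_measureI)
  let ?A = "{x :: real ^ 'd. 0 < norm x \<and> norm x \<le> 1 \<and> x /\<^sub>R norm x \<in> sphere 0 1}"
  have "emeasure sphere_measure (space (sphere_measure :: (real ^ 'd) measure)) =
      of_nat CARD('d) * emeasure lborel ?A"
    unfolding space_sphere_measure by (rule emeasure_sphere_measure) auto
  also have "\<dots> < \<infinity>"
  proof -
    have "bounded ?A" by (rule bounded_subset[OF bounded_cball[of 0 1]]) auto
    then have "emeasure lborel ?A < \<infinity>" by (rule emeasure_bounded_finite)
    then show ?thesis by (simp add: ennreal_mult_less_top of_nat_less_top)
  qed
  finally show "emeasure sphere_measure (space (sphere_measure :: (real ^ 'd) measure)) \<noteq> \<infinity>" by simp
qed

text \<open>
  Null sets of the sphere are recognised by the Lebesgue null cones over them; on cones the normalised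
  map \<open>\<tau>\<close> can be replaced by a linear map.
\<close>

lemma null_sets_sphere_measure_iff:
  fixes N :: "(real ^ 'd) set"
  shows "N \<in> null_sets sphere_measure \<longleftrightarrow> N \<in> sets borel \<and> N \<subseteq> sphere 0 1 \<and>
    negligible {x. 0 < norm x \<and> norm x \<le> 1 \<and> x /\<^sub>R norm x \<in> N}"
proof -
  let ?C = "{x. 0 < norm x \<and> norm x \<le> 1 \<and> x /\<^sub>R norm x \<in> N}"
  have sets: "N \<in> sets sphere_measure \<longleftrightarrow> N \<in> sets borel \<and> N \<subseteq> sphere 0 1"
    unfolding sets_sphere_measure by (auto simp: sets_restrict_space_iff)
  have "emeasure sphere_measure N = 0 \<longleftrightarrow> negligible ?C" if N: "N \<in> sets borel" "N \<subseteq> sphere 0 1"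
  proof -
    have "?C \<in> sets borel" using N(1) by measurable
    then have "?C \<in> sets lborel" by simp
    then have "negligible ?C \<longleftrightarrow> emeasure lborel ?C = 0"
      by (simp add: negligible_iff_emeasure0 sets_completionI_sets)
    then show ?thesis unfolding emeasure_sphere_measure[OF N] by simp
  qed
  then show ?thesis using sets by (auto simp: null_sets_def)
qed

text \<open>
  The cone over the preimage is mapped by the matrix \<open>A\<close> into the cone over \<open>N\<close>. As \<open>A\<close> has a linear left inverse
  and linear maps preserve Lebesgue null sets, the cone over the preimage is null.
\<close>

lemma null_sets_pca_step_vimage:
  fixes N :: "(real ^ 'd) set"
  assumes N: "N \<in> null_sets sphere_measure" and "\<eta> \<ge> 0"
  shows "{w \<in> sphere 0 1. pca_step \<eta> \<xi> w \<in> N} \<in> null_sets sphere_measure"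
proof -
  let ?A = "{w \<in> sphere 0 1. pca_step \<eta> \<xi> w \<in> N}"
  let ?cone = "\<lambda>M :: (real ^ 'd) set. {x. 0 < norm x \<and> norm x \<le> 1 \<and> x /\<^sub>R norm x \<in> M}"
  have N': "N \<in> sets borel" "negligible (?cone N)"
    using N by (auto simp: null_sets_sphere_measure_iff)
  \<comment> \<open>the factor \<open>c\<close> makes the matrix a contraction, so that it maps cones truncated at radius \<open>1\<close> to such cones\<close>
  define c where "c = inverse (1 + \<eta> * (norm \<xi> * norm \<xi>))"
  have c: "c > 0" unfolding c_def using \<open>\<eta> \<ge> 0\<close> by (simp add: add_pos_nonneg)
  define L where "L x = c *\<^sub>R stretch \<eta> \<xi> x" for x
  have linL: "linear L"
    unfolding L_def[abs_def] by (intro linear_compose_scale_right linear_stretch)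
  have nz: "stretch \<eta> \<xi> x \<noteq> 0" if "x \<noteq> 0" for x
    using norm_stretch_ge[OF \<open>\<eta> \<ge> 0\<close>, of x \<xi>] that by auto
  have "inj L" using c nz by (auto simp: linear_injective_0[OF linL] L_def)
  then obtain g where g: "linear g" "g \<circ> L = id"
    using linear_injective_left_inverse[OF linL] by blast
  have Lball: "norm (L x) \<le> norm x" for x
  proof -
    have "norm (stretch \<eta> \<xi> x) \<le> norm x + \<bar>\<eta>\<bar> * (\<bar>\<xi> \<bullet> x\<bar> * norm \<xi>)"
      unfolding stretch_def by (rule order_trans[OF norm_triangle_ineq]) (simp add: abs_mult)
    also have "\<dots> \<le> norm x + \<bar>\<eta>\<bar> * ((norm \<xi> * norm x) * norm \<xi>)"
      by (intro add_left_mono mult_left_mono mult_right_mono Cauchy_Schwarz_ineq2) auto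
    also have "\<dots> = inverse c * norm x" using \<open>\<eta> \<ge> 0\<close> by (simp add: c_def algebra_simps)
    finally show ?thesis using c by (simp add: L_def field_simps)
  qed
  have "?cone ?A \<subseteq> g ` ?cone N"
  proof
    fix x assume x: "x \<in> ?cone ?A"
    then have x0: "x \<noteq> 0" by auto
    have "pca_step \<eta> \<xi> (sgn x) \<in> N" using x by (simp add: sgn_div_norm)
    moreover have "pca_step \<eta> \<xi> (sgn x) = L x /\<^sub>R norm (L x)"
    proof -
      have "sgn (L x) = sgn (stretch \<eta> \<xi> x)" using c by (simp add: L_def sgn_scaleR)
      then show ?thesis by (simp only: pca_step_sgn sgn_div_norm[of "L x"])
    qed
    moreover have "L x \<noteq> 0" using c nz[OF x0] by (simp add: L_def)
    moreover have "norm (L x) \<le> 1" using Lball[of x] x by auto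
    ultimately have Lx: "L x \<in> ?cone N" by simp
    have "x = g (L x)" using fun_cong[OF g(2), of x] by simp
    then show "x \<in> g ` ?cone N" using Lx by (rule image_eqI)
  qed
  moreover have "negligible (g ` ?cone N)"
  proof (rule negligible_differentiable_image_negligible[OF order_refl N'(2)])
    show "g differentiable_on ?cone N"
      using g(1) by (simp add: linear_imp_differentiable_on)
  qed
  ultimately have "negligible (?cone ?A)" by (rule negligible_subset[rotated])
  moreover have "?A \<in> sets borel"
  proof -
    have "pca_step \<eta> \<xi> \<in> borel_measurable borel" unfolding pca_step_def[abs_def] by measurable
    from measurable_sets[OF this N'(1)] have "pca_step \<eta> \<xi> -` N \<in> sets borel" by simp
    then have "sphere 0 1 \<inter> pca_step \<eta> \<xi> -` N \<in> sets borel" by (intro sets.Int) auto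
    then show ?thesis by (simp add: Int_def vimage_def)
  qed
  ultimately show ?thesis by (auto simp: null_sets_sphere_measure_iff)
qed

locale pca =
  fixes \<nu> :: "(real ^ 'd) measure" and \<eta> :: real
  assumes prob: "prob_space \<nu>" and sets_nu: "sets \<nu> = sets borel" and eta: "\<eta> \<ge> 0"
begin

sublocale nu: prob_space \<nu> by (rule prob)

abbreviation \<sigma> :: "(real ^ 'd) measure" where "\<sigma> \<equiv> sphere_measure"

sublocale sphere: finite_measure \<sigma> by (rule finite_sphere_measure)

sublocale pair_sigma_finite \<sigma> \<nu> ..

text \<open>
  The point comes first, so that Fubini integrates over the sample first, as \<open>S\<close> does.
\<close>

definition step :: "(real ^ 'd) \<times> (real ^ 'd) \<Rightarrow> real ^ 'd" where
  "step p = pca_step \<eta> (snd p) (fst p)"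

lemma measurable_step: "step \<in> measurable (\<sigma> \<Otimes>\<^sub>M \<nu>) \<sigma>"
proof -
  have id: "(\<lambda>w. w) \<in> borel_measurable \<sigma>"
    unfolding measurable_cong_sets[OF sets_sphere_measure refl] by (rule measurable_restrict_space1) simp
  have f [measurable]: "fst \<in> borel_measurable (\<sigma> \<Otimes>\<^sub>M \<nu>)"
    by (rule measurable_compose[OF measurable_fst id])
  have s [measurable]: "snd \<in> borel_measurable (\<sigma> \<Otimes>\<^sub>M \<nu>)"
    using measurable_snd[of \<sigma> \<nu>] measurable_cong_sets[OF refl sets_nu] by blast
  have "step \<in> borel_measurable (\<sigma> \<Otimes>\<^sub>M \<nu>)" unfolding step_def[abs_def] pca_step_def by measurable
  moreover have "step \<in> space (\<sigma> \<Otimes>\<^sub>M \<nu>) \<rightarrow> sphere 0 1"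
    using pca_step_sphere[OF eta] by (auto simp: step_def space_pair_measure space_sphere_measure simp del: mem_sphere_0)
  ultimately show ?thesis
    unfolding measurable_cong_sets[OF refl sets_sphere_measure] by (intro measurable_restrict_space2)
qed

text \<open>
  For each \<open>\<xi>\<close> separately this is \<open>null_sets_pca_step_vimage\<close>; Fubini exchanges the two quantifiers. It is the
  reason why \<open>S\<close> and its dual are well defined on classes of functions.
\<close>

lemma AE_step:
  assumes Q: "AE w in \<sigma>. Q w"
  shows "AE w in \<sigma>. AE \<xi> in \<nu>. Q (step (w, \<xi>))"
proof -
  obtain N where N: "N \<in> null_sets \<sigma>" "{w \<in> space \<sigma>. \<not> Q w} \<subseteq> N"
    using Q unfolding eventually_ae_filter by blast
  have "AE w in \<sigma>. step (w, \<xi>) \<notin> N" for \<xi>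
  proof (rule AE_I'[OF null_sets_pca_step_vimage[OF N(1) eta]])
    show "{w \<in> space \<sigma>. \<not> step (w, \<xi>) \<notin> N} \<subseteq> {w \<in> sphere 0 1. pca_step \<eta> \<xi> w \<in> N}"
      by (auto simp: step_def space_sphere_measure)
  qed
  then have "AE \<xi> in \<nu>. AE w in \<sigma>. step (w, \<xi>) \<notin> N" by simp
  moreover have "{p \<in> space (\<sigma> \<Otimes>\<^sub>M \<nu>). step (fst p, snd p) \<notin> N} \<in> sets (\<sigma> \<Otimes>\<^sub>M \<nu>)"
  proof -
    have "step -` N \<inter> space (\<sigma> \<Otimes>\<^sub>M \<nu>) \<in> sets (\<sigma> \<Otimes>\<^sub>M \<nu>)"
      using N(1) by (intro measurable_sets[OF measurable_step]) auto
    then have "space (\<sigma> \<Otimes>\<^sub>M \<nu>) - step -` N \<inter> space (\<sigma> \<Otimes>\<^sub>M \<nu>) \<in> sets (\<sigma> \<Otimes>\<^sub>M \<nu>)" by auto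
    also have "space (\<sigma> \<Otimes>\<^sub>M \<nu>) - step -` N \<inter> space (\<sigma> \<Otimes>\<^sub>M \<nu>) =
        {p \<in> space (\<sigma> \<Otimes>\<^sub>M \<nu>). step (fst p, snd p) \<notin> N}" by auto
    finally show ?thesis .
  qed
  ultimately have "AE w in \<sigma>. AE \<xi> in \<nu>. step (w, \<xi>) \<notin> N"
    using AE_commute[of "\<lambda>w \<xi>. step (w, \<xi>) \<notin> N"] by simp
  moreover have "AE w in \<sigma>. w \<in> space \<sigma>" by simp
  ultimately show ?thesis
  proof eventually_elim
    case (elim w)
    have "step (w, \<xi>) \<in> space \<sigma>" for \<xi>
      using pca_step_sphere[OF eta] elim(2) by (simp add: step_def space_sphere_measure del: mem_sphere_0)
    then have "step (w, \<xi>) \<notin> N \<Longrightarrow> Q (step (w, \<xi>))" for \<xi> using N(2) by blast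
    then show ?case using elim(1) by (auto elim: eventually_mono)
  qed
qed

lemma pca_S_eq: "pca_S \<nu> \<eta> u w = (LINT \<xi>|\<nu>. u (step (w, \<xi>)))"
  by (simp add: pca_S_def step_def)

lemma measurable_step_fibre:
  assumes "u \<in> borel_measurable \<sigma>" "w \<in> space \<sigma>"
  shows "(\<lambda>\<xi>. u (step (w, \<xi>))) \<in> borel_measurable \<nu>"
  using measurable_compose[OF measurable_Pair1'[OF assms(2)] measurable_compose[OF measurable_step assms(1)]]
  by simp

lemma measurable_pca_S:
  assumes "u \<in> borel_measurable \<sigma>"
  shows "pca_S \<nu> \<eta> u \<in> borel_measurable \<sigma>"
  unfolding pca_S_eq[abs_def]
  using measurable_compose[OF measurable_step assms]
  by (intro nu.borel_measurable_lebesgue_integral) simp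

lemma AE_space: "AE w in \<sigma>. w \<in> space \<sigma>"
  by simp

lemma Linf_bounded:
  assumes "u \<in> Linf"
  obtains c where "AE w in \<sigma>. \<bar>u w\<bar> \<le> c"
proof -
  have lt: "Linf_norm u < \<infinity>" using assms by (simp add: Linf_def Linf_norm_def)
  obtain c where "Linf_norm u \<le> ereal c"
    using lt by (cases "Linf_norm u") auto
  moreover have "AE w in \<sigma>. ereal \<bar>u w\<bar> \<le> Linf_norm u"
    unfolding Linf_norm_def by (rule esssup_AE)
  ultimately have "AE w in \<sigma>. \<bar>u w\<bar> \<le> c"
    by (auto elim!: eventually_mono dest: order_trans)
  then show ?thesis using that by blast
qed

lemma AE_integrable_step:
  assumes u: "u \<in> Linf"
  shows "AE w in \<sigma>. integrable \<nu> (\<lambda>\<xi>. u (step (w, \<xi>)))"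
proof -
  obtain c where "AE w in \<sigma>. \<bar>u w\<bar> \<le> c" by (rule Linf_bounded[OF u])
  from AE_step[OF this] AE_space show ?thesis
  proof eventually_elim
    case (elim w)
    then show ?case
      using u by (intro nu.integrable_const_bound[where B=c] measurable_step_fibre) (auto simp: Linf_def)
  qed
qed

lemma pca_S_contraction:
  assumes u: "u \<in> Linf"
  shows "Linf_norm (pca_S \<nu> \<eta> u) \<le> Linf_norm u"
proof -
  have um: "u \<in> borel_measurable \<sigma>" using u by (simp add: Linf_def)
  have lt: "Linf_norm u < \<infinity>" using u by (simp add: Linf_def Linf_norm_def)
  have "AE w in \<sigma>. ereal \<bar>u w\<bar> \<le> Linf_norm u"
    unfolding Linf_norm_def by (rule esssup_AE)
  from AE_step[OF this] AE_integrable_step[OF u]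
  have "AE w in \<sigma>. ereal \<bar>pca_S \<nu> \<eta> u w\<bar> \<le> Linf_norm u"
  proof eventually_elim
    case (elim w)
    show ?case
    proof (cases "Linf_norm u")
      case (real c)
      then have "AE \<xi> in \<nu>. norm (u (step (w, \<xi>))) \<le> c" using elim by simp
      from norm_expectation_le[OF prob elim(2) this] show ?thesis using real by (simp add: pca_S_eq)
    next
      case MInf
      then have "AE \<xi> in \<nu>. False" using elim by simp
      then show ?thesis by simp
    qed (use lt in simp)
  qed
  then show ?thesis
    using measurable_pca_S[OF um] unfolding Linf_norm_def[of "pca_S \<nu> \<eta> u"]
    by (intro esssup_I) simp_all
qed

lemma pca_S_maps_classes: "maps_classes (pca_S \<nu> \<eta>) Linf"
  unfolding maps_classes_def
proof (intro conjI ballI impI)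
  fix u assume u: "u \<in> (Linf :: (real ^ 'd \<Rightarrow> real) set)"
  have um: "u \<in> borel_measurable \<sigma>" and lt: "Linf_norm u < \<infinity>"
    using u by (simp_all add: Linf_def Linf_norm_def)
  show "pca_S \<nu> \<eta> u \<in> Linf"
    using measurable_pca_S[OF um] le_less_trans[OF pca_S_contraction[OF u] lt]
    by (simp add: Linf_def Linf_norm_def)
  fix v assume v: "v \<in> (Linf :: (real ^ 'd \<Rightarrow> real) set)" and uv: "AE w in \<sigma>. u w = v w"
  have vm: "v \<in> borel_measurable \<sigma>" using v by (simp add: Linf_def)
  from AE_step[OF uv] AE_space show "AE w in \<sigma>. pca_S \<nu> \<eta> u w = pca_S \<nu> \<eta> v w"
  proof eventually_elim
    case (elim w)
    then show ?case unfolding pca_S_eq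
      by (intro integral_cong_AE measurable_step_fibre um vm) auto
  qed
qed

text \<open>
  The law, averaged over the sample, of the chain after one step from a point distributed according to
  \<open>f dS\<close>. For integrable \<open>f\<close> its mass is finite, so the Radon--Nikodym derivative is finite almost everywhere and
  \<open>enn2real\<close> loses nothing.
\<close>

definition transport :: "(real ^ 'd \<Rightarrow> real) \<Rightarrow> (real ^ 'd) measure" where
  "transport f = distr (density \<sigma> (\<lambda>w. ennreal (f w)) \<Otimes>\<^sub>M \<nu>) \<sigma> step"

definition transport_density :: "(real ^ 'd \<Rightarrow> real) \<Rightarrow> real ^ 'd \<Rightarrow> real" where
  "transport_density f w = enn2real (RN_deriv \<sigma> (transport f) w)"

lemma transport_cong:
  assumes "f \<in> borel_measurable \<sigma>" "g \<in> borel_measurable \<sigma>" "AE w in \<sigma>. f w = g w"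
  shows "transport f = transport g"
proof -
  have "density \<sigma> (\<lambda>w. ennreal (f w)) = density \<sigma> (\<lambda>w. ennreal (g w))"
    using assms by (intro density_cong) (auto elim: eventually_mono)
  then show ?thesis by (simp add: transport_def)
qed

lemma finite_density:
  assumes f: "integrable \<sigma> f"
  shows "finite_measure (density \<sigma> (\<lambda>w. ennreal (f w)))"
proof (rule finite_measureI)
  have [measurable]: "f \<in> borel_measurable \<sigma>" using f by simp
  have "emeasure (density \<sigma> (\<lambda>w. ennreal (f w))) (space \<sigma>) = (\<integral>\<^sup>+w. ennreal (f w) \<partial>\<sigma>)"
    by (subst emeasure_density) (auto intro!: nn_integral_cong)
  also have "\<dots> \<le> (\<integral>\<^sup>+w. ennreal (norm (f w)) \<partial>\<sigma>)"
    by (intro nn_integral_mono) (auto intro: ennreal_leI)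
  also have "\<dots> < \<infinity>" using f by (simp add: integrable_iff_bounded)
  finally show "emeasure (density \<sigma> (\<lambda>w. ennreal (f w))) (space (density \<sigma> (\<lambda>w. ennreal (f w)))) \<noteq> \<infinity>"
    by simp
qed

lemma measurable_step_density: "step \<in> measurable (density \<sigma> (\<lambda>w. ennreal (f w)) \<Otimes>\<^sub>M \<nu>) \<sigma>"
proof -
  have "sets (density \<sigma> (\<lambda>w. ennreal (f w)) \<Otimes>\<^sub>M \<nu>) = sets (\<sigma> \<Otimes>\<^sub>M \<nu>)"
    by (rule sets_pair_measure_cong) simp_all
  then show ?thesis using measurable_step measurable_cong_sets by blast
qed

lemma finite_transport:
  assumes "integrable \<sigma> f"
  shows "finite_measure (transport f)"
proof -
  have "finite_measure (density \<sigma> (\<lambda>w. ennreal (f w)) \<Otimes>\<^sub>M \<nu>)"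
    by (intro finite_measure_pair_measure finite_density assms nu.finite_measure_axioms)
  then show ?thesis unfolding transport_def
    by (rule finite_measure.finite_measure_distr) (rule measurable_step_density)
qed

lemma sets_transport: "sets (transport f) = sets \<sigma>"
  by (simp add: transport_def)

lemma absolutely_continuous_transport:
  assumes f: "integrable \<sigma> f"
  shows "absolutely_continuous \<sigma> (transport f)"
  unfolding absolutely_continuous_def
proof
  fix N assume N: "N \<in> null_sets \<sigma>"
  let ?D = "density \<sigma> (\<lambda>w. ennreal (f w))"
  have fm: "f \<in> borel_measurable \<sigma>" using f by simp
  interpret D: finite_measure ?D by (rule finite_density[OF f])
  interpret P: pair_sigma_finite ?D \<nu> ..
  have sN: "N \<in> sets \<sigma>" using N by auto
  have "AE w in \<sigma>. AE \<xi> in \<nu>. step (w, \<xi>) \<notin> N"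
    by (rule AE_step) (rule AE_not_in[OF N])
  then have "AE w in ?D. AE \<xi> in \<nu>. step (w, \<xi>) \<notin> N"
    using fm by (subst AE_density) (auto elim: eventually_mono)
  moreover have meas: "step -` N \<inter> space (?D \<Otimes>\<^sub>M \<nu>) \<in> sets (?D \<Otimes>\<^sub>M \<nu>)"
    using sN by (intro measurable_sets[OF measurable_step_density])
  moreover have "{p \<in> space (?D \<Otimes>\<^sub>M \<nu>). step p \<notin> N} =
      space (?D \<Otimes>\<^sub>M \<nu>) - step -` N \<inter> space (?D \<Otimes>\<^sub>M \<nu>)" by auto
  ultimately have "AE p in ?D \<Otimes>\<^sub>M \<nu>. step p \<notin> N"
    by (intro P.AE_pair_measure) (simp_all only: sets.compl_sets)
  then have "emeasure (?D \<Otimes>\<^sub>M \<nu>) (step -` N \<inter> space (?D \<Otimes>\<^sub>M \<nu>)) = 0"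
    by (subst (asm) AE_iff_measurable[OF meas]) auto
  then show "N \<in> null_sets (transport f)"
    using sN unfolding transport_def null_sets_def
    by (simp add: emeasure_distr[OF measurable_step_density])
qed

lemma measurable_transport_density: "transport_density f \<in> borel_measurable \<sigma>"
  unfolding transport_density_def[abs_def] by measurable

lemma density_transport_density:
  assumes f: "integrable \<sigma> f"
  shows "density \<sigma> (\<lambda>w. ennreal (transport_density f w)) = transport f"
proof -
  interpret T: finite_measure "transport f" by (rule finite_transport[OF f])
  note ac = absolutely_continuous_transport[OF f] sets_transport[of f]
  have "AE w in \<sigma>. RN_deriv \<sigma> (transport f) w \<noteq> \<infinity>"
    by (rule sphere.RN_deriv_finite[OF T.sigma_finite_measure_axioms ac])
  then have "AE w in \<sigma>. ennreal (transport_density f w) = RN_deriv \<sigma> (transport f) w"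
    by eventually_elim (simp add: transport_density_def less_top)
  then have "density \<sigma> (\<lambda>w. ennreal (transport_density f w)) = density \<sigma> (RN_deriv \<sigma> (transport f))"
    using measurable_transport_density[of f] by (intro density_cong) auto
  also have "\<dots> = transport f" by (rule sphere.density_RN_deriv[OF ac])
  finally show ?thesis .
qed

lemma transport_density_nonneg: "0 \<le> transport_density f w"
  by (simp add: transport_density_def)

text \<open>
  Both integrals are the integral of \<open>u\<close> against the transported measure: one through its density, the
  other through the definition as an image measure and Fubini.
\<close>

lemma transport_density_duality:
  assumes f: "integrable \<sigma> f" and nonneg: "\<And>w. 0 \<le> f w" and u: "u \<in> Linf"
  shows "integrable \<sigma> (\<lambda>w. u w * transport_density f w)"
    and "integrable \<sigma> (\<lambda>w. pca_S \<nu> \<eta> u w * f w)"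
    and "(LINT w|\<sigma>. u w * transport_density f w) = (LINT w|\<sigma>. pca_S \<nu> \<eta> u w * f w)"
proof -
  let ?D = "density \<sigma> (\<lambda>w. ennreal (f w))" and ?s = "transport_density f"
  have fm: "f \<in> borel_measurable \<sigma>" using f by simp
  have um: "u \<in> borel_measurable \<sigma>" using u by (simp add: Linf_def)
  note sm = measurable_transport_density[of f]
  note T = density_transport_density[OF f]
  obtain c where c: "AE w in \<sigma>. \<bar>u w\<bar> \<le> c" by (rule Linf_bounded[OF u])
  interpret D: finite_measure ?D by (rule finite_density[OF f])
  interpret P: pair_sigma_finite ?D \<nu> ..
  interpret T: finite_measure "transport f" by (rule finite_transport[OF f])
  have "AE w in density \<sigma> (\<lambda>w. ennreal (?s w)). norm (u w) \<le> c"
    using c sm by (subst AE_density) (auto elim: eventually_mono)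
  then have intT: "integrable (transport f) u"
    unfolding T using um measurable_cong_sets[OF sets_transport[of f] refl]
    by (intro T.integrable_const_bound) auto
  then show "integrable \<sigma> (\<lambda>w. u w * ?s w)"
    unfolding T[symmetric] using integrable_density[OF um sm] transport_density_nonneg[of f]
    by (simp add: mult.commute)
  have intP: "integrable (?D \<Otimes>\<^sub>M \<nu>) (\<lambda>p. u (step p))"
    using integrable_distr[OF measurable_step_density intT[unfolded transport_def]] .
  have "integrable ?D (pca_S \<nu> \<eta> u)"
    using P.integrable_fst'[OF intP] unfolding pca_S_eq[abs_def] .
  then show "integrable \<sigma> (\<lambda>w. pca_S \<nu> \<eta> u w * f w)"
    using integrable_density[OF measurable_pca_S[OF um] fm] nonneg by (simp add: mult.commute)
  have "(LINT w|\<sigma>. u w * ?s w) = (LINT w|density \<sigma> (\<lambda>w. ennreal (?s w)). u w)"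
    using integral_density[OF um sm] transport_density_nonneg[of f] by (simp add: mult.commute)
  also have "\<dots> = (LINT p|(?D \<Otimes>\<^sub>M \<nu>). u (step p))"
    unfolding T transport_def by (rule integral_distr[OF measurable_step_density um])
  also have "\<dots> = (LINT w|?D. pca_S \<nu> \<eta> u w)"
    unfolding pca_S_eq by (rule P.integral_fst'[OF intP, symmetric])
  also have "\<dots> = (LINT w|\<sigma>. pca_S \<nu> \<eta> u w * f w)"
    using integral_density[OF measurable_pca_S[OF um] fm] nonneg by (simp add: mult.commute)
  finally show "(LINT w|\<sigma>. u w * ?s w) = (LINT w|\<sigma>. pca_S \<nu> \<eta> u w * f w)" .
qed

lemma one_in_Linf: "(\<lambda>w. 1) \<in> (Linf :: (real ^ 'd \<Rightarrow> real) set)"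
proof -
  have "esssup \<sigma> (\<lambda>w. ereal \<bar>1 :: real\<bar>) \<le> ereal 1" by (rule esssup_I) auto
  then have "esssup \<sigma> (\<lambda>w. ereal \<bar>1 :: real\<bar>) < \<infinity>" by (rule le_less_trans) simp
  then show ?thesis unfolding Linf_def by simp
qed

text \<open>
  Duality tested with \<open>u = 1\<close>, since \<open>S 1 = 1\<close>.
\<close>

lemma transport_density_mass:
  assumes "integrable \<sigma> f" "\<And>w. 0 \<le> f w"
  shows "integrable \<sigma> (transport_density f)"
    and "(LINT w|\<sigma>. transport_density f w) = (LINT w|\<sigma>. f w)"
  using transport_density_duality[OF assms one_in_Linf]
  by (simp_all add: pca_S_def nu.prob_space)

definition S_dual :: "(real ^ 'd \<Rightarrow> real) \<Rightarrow> (real ^ 'd \<Rightarrow> real)" where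
  "S_dual \<rho> w = transport_density (\<lambda>w. max 0 (\<rho> w)) w - transport_density (\<lambda>w. max 0 (- \<rho> w)) w"

lemma integrable_pos_neg:
  fixes \<rho> :: "real ^ 'd \<Rightarrow> real"
  assumes "integrable \<sigma> \<rho>"
  shows "integrable \<sigma> (\<lambda>w. max 0 (\<rho> w))" "integrable \<sigma> (\<lambda>w. max 0 (- \<rho> w))"
  using assms by simp_all

lemma S_dual_maps_classes: "maps_classes S_dual L1"
  unfolding maps_classes_def
proof (intro conjI ballI impI)
  fix \<rho> assume "\<rho> \<in> (L1 :: (real ^ 'd \<Rightarrow> real) set)"
  then have r: "integrable \<sigma> \<rho>" by (simp add: L1_def)
  note pn = integrable_pos_neg[OF r]
  show "S_dual \<rho> \<in> L1"
    unfolding L1_def S_dual_def[abs_def] using transport_density_mass(1)[OF pn(1)] transport_density_mass(1)[OF pn(2)]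
    by simp
  fix \<rho>' assume "\<rho>' \<in> (L1 :: (real ^ 'd \<Rightarrow> real) set)" and e: "AE w in \<sigma>. \<rho> w = \<rho>' w"
  then have r': "integrable \<sigma> \<rho>'" by (simp add: L1_def)
  note pn' = integrable_pos_neg[OF r']
  have "transport (\<lambda>w. max 0 (\<rho> w)) = transport (\<lambda>w. max 0 (\<rho>' w))"
    "transport (\<lambda>w. max 0 (- \<rho> w)) = transport (\<lambda>w. max 0 (- \<rho>' w))"
    using e pn pn' by (auto intro!: transport_cong elim: eventually_mono)
  then have "S_dual \<rho> = S_dual \<rho>'"
    by (simp add: S_dual_def[abs_def] transport_density_def)
  then show "AE w in \<sigma>. S_dual \<rho> w = S_dual \<rho>' w" by simp
qed

lemma S_dual_duality:
  assumes u: "u \<in> Linf" and "\<rho> \<in> L1"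
  shows "(LINT w|\<sigma>. pca_S \<nu> \<eta> u w * \<rho> w) = (LINT w|\<sigma>. u w * S_dual \<rho> w)"
proof -
  have r: "integrable \<sigma> \<rho>" using assms by (simp add: L1_def)
  note pn = integrable_pos_neg[OF r]
  note p = transport_density_duality[OF pn(1) max.cobounded1 u]
  note n = transport_density_duality[OF pn(2) max.cobounded1 u]
  have "\<rho> w = max 0 (\<rho> w) - max 0 (- \<rho> w)" for w by simp
  then have "(LINT w|\<sigma>. pca_S \<nu> \<eta> u w * \<rho> w) =
      (LINT w|\<sigma>. pca_S \<nu> \<eta> u w * max 0 (\<rho> w) - pca_S \<nu> \<eta> u w * max 0 (- \<rho> w))"
    by (metis (no_types) right_diff_distrib)
  also have "\<dots> = (LINT w|\<sigma>. u w * S_dual \<rho> w)"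
    using p n by (simp add: S_dual_def right_diff_distrib)
  finally show ?thesis .
qed

text \<open>
  The triangle inequality for the two parts, each of which keeps its mass.
\<close>

lemma S_dual_contraction:
  assumes "\<rho> \<in> L1"
  shows "L1_norm (S_dual \<rho>) \<le> L1_norm \<rho>"
proof -
  have r: "integrable \<sigma> \<rho>" using assms by (simp add: L1_def)
  note pn = integrable_pos_neg[OF r]
  note p = transport_density_mass[OF pn(1) max.cobounded1]
  note n = transport_density_mass[OF pn(2) max.cobounded1]
  let ?p = "transport_density (\<lambda>w. max 0 (\<rho> w))" and ?n = "transport_density (\<lambda>w. max 0 (- \<rho> w))"
  have "L1_norm (S_dual \<rho>) \<le> (LINT w|\<sigma>. ?p w + ?n w)"
    unfolding L1_norm_def S_dual_def
    using p(1) n(1) by (intro integral_mono) (auto simp: abs_le_iff transport_density_nonneg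
        intro: order_trans[OF _ add_increasing2] add_increasing)
  also have "\<dots> = (LINT w|\<sigma>. max 0 (\<rho> w) + max 0 (- \<rho> w))"
    using p n pn by simp
  also have "\<dots> = L1_norm \<rho>"
    unfolding L1_norm_def by (intro Bochner_Integration.integral_cong) auto
  finally show ?thesis .
qed

lemma S_dual_positive:
  assumes "\<rho> \<in> L1" and nonneg: "AE w in \<sigma>. 0 \<le> \<rho> w"
  shows "AE w in \<sigma>. 0 \<le> S_dual \<rho> w" and "L1_norm (S_dual \<rho>) = L1_norm \<rho>"
proof -
  have r: "integrable \<sigma> \<rho>" using assms by (simp add: L1_def)
  note pn = integrable_pos_neg[OF r]
  note p = transport_density_mass[OF pn(1) max.cobounded1]
  note n = transport_density_mass[OF pn(2) max.cobounded1]
  let ?p = "transport_density (\<lambda>w. max 0 (\<rho> w))" and ?n = "transport_density (\<lambda>w. max 0 (- \<rho> w))"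
  have "(LINT w|\<sigma>. ?n w) = 0"
    unfolding n(2) using nonneg by (intro integral_eq_zero_AE) (auto elim: eventually_mono)
  then have "AE w in \<sigma>. ?n w = 0"
    using integral_nonneg_eq_0_iff_AE[OF n(1)] transport_density_nonneg by simp
  then have e: "AE w in \<sigma>. S_dual \<rho> w = ?p w"
    by eventually_elim (simp add: S_dual_def)
  then show "AE w in \<sigma>. 0 \<le> S_dual \<rho> w"
    by eventually_elim (simp add: transport_density_nonneg)
  have "integrable \<sigma> (S_dual \<rho>)"
    using p(1) n(1) unfolding S_dual_def[abs_def] by (rule Bochner_Integration.integrable_diff)
  then have "L1_norm (S_dual \<rho>) = (LINT w|\<sigma>. ?p w)"
    unfolding L1_norm_def using e measurable_transport_density
    by (intro integral_cong_AE) (auto elim!: eventually_mono simp: transport_density_nonneg)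
  also have "\<dots> = L1_norm \<rho>"
    unfolding p(2) L1_norm_def using nonneg r
    by (intro integral_cong_AE) (auto elim: eventually_mono)
  finally show "L1_norm (S_dual \<rho>) = L1_norm \<rho>" .
qed

end

section \<open>The three properties of the chain\<close>

theorem proposition3p1:
  fixes \<nu> :: "(real ^ 'd) measure" and B T :: real
  assumes "prob_space \<nu>" and "sets \<nu> = sets borel"
    and "B > 0" and "AE \<xi> in \<nu>. norm \<xi> \<le> B"
    and "T > 0"
  shows
    "(\<forall>\<eta>>0. maps_classes (pca_S \<nu> \<eta>) Linf \<and>
        (\<forall>u\<in>Linf. (AE w in sphere_measure. integrable \<nu> (\<lambda>\<xi>. u (pca_step \<eta> \<xi> w))) \<and>
                  Linf_norm (pca_S \<nu> \<eta> u) \<le> Linf_norm u))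
   \<and> (\<forall>k. \<exists>\<eta>\<^sub>0>0. \<exists>C. \<forall>\<phi>. Ck_sphere k \<phi> \<longrightarrow>
        (\<forall>\<eta> n. 0 < \<eta> \<and> \<eta> \<le> \<eta>\<^sub>0 \<and> real n * \<eta> \<le> T \<longrightarrow>
           Ck_sphere k (pca_u \<nu> \<eta> \<phi> n) \<and>
           Ck_norm k (pca_u \<nu> \<eta> \<phi> n) \<le> C * Ck_norm k \<phi>))
   \<and> (\<forall>\<eta>>0. \<exists>S_star :: (real ^ 'd \<Rightarrow> real) \<Rightarrow> (real ^ 'd \<Rightarrow> real).
        maps_classes S_star L1 \<and>
        (\<forall>u\<in>Linf. \<forall>\<rho>\<in>L1.
           (LINT w|sphere_measure. pca_S \<nu> \<eta> u w * \<rho> w) =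
           (LINT w|sphere_measure. u w * S_star \<rho> w)) \<and>
        (\<forall>\<rho>\<in>L1. L1_norm (S_star \<rho>) \<le> L1_norm \<rho>) \<and>
        (\<forall>\<rho>\<in>L1. (AE w in sphere_measure. 0 \<le> \<rho> w) \<longrightarrow>
           (AE w in sphere_measure. 0 \<le> S_star \<rho> w) \<and> L1_norm (S_star \<rho>) = L1_norm \<rho>))"
proof -
  have B: "B \<ge> 0" using \<open>B > 0\<close> by simp
  have loc: "pca \<nu> \<eta>" if "\<eta> > 0" for \<eta>
    using assms(1,2) that by (simp add: pca_def)
  have i: "maps_classes (pca_S \<nu> \<eta>) Linf \<and>
      (\<forall>u\<in>Linf. (AE w in sphere_measure. integrable \<nu> (\<lambda>\<xi>. u (pca_step \<eta> \<xi> w))) \<and>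
         Linf_norm (pca_S \<nu> \<eta> u) \<le> Linf_norm u)" if "\<eta> > 0" for \<eta>
  proof -
    interpret pca \<nu> \<eta> by (rule loc[OF that])
    show ?thesis
      using pca_S_maps_classes AE_integrable_step pca_S_contraction by (simp add: step_def)
  qed
  have ii: "\<exists>\<eta>\<^sub>0>0. \<exists>C. \<forall>\<phi>. Ck_sphere k \<phi> \<longrightarrow>
      (\<forall>\<eta> n. 0 < \<eta> \<and> \<eta> \<le> \<eta>\<^sub>0 \<and> real n * \<eta> \<le> T \<longrightarrow>
         Ck_sphere k (pca_u \<nu> \<eta> \<phi> n) \<and> Ck_norm k (pca_u \<nu> \<eta> \<phi> n) \<le> C * Ck_norm k \<phi>)" for k
    by (rule exI[of _ 1]) (rule conjI[OF zero_less_one pca_u_Ck_bound[OF assms(1,2,4) B]])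
  have iii: "\<exists>S_star. maps_classes S_star L1 \<and>
      (\<forall>u\<in>Linf. \<forall>\<rho>\<in>L1. (LINT w|sphere_measure. pca_S \<nu> \<eta> u w * \<rho> w) =
         (LINT w|sphere_measure. u w * S_star \<rho> w)) \<and>
      (\<forall>\<rho>\<in>L1. L1_norm (S_star \<rho>) \<le> L1_norm \<rho>) \<and>
      (\<forall>\<rho>\<in>L1. (AE w in sphere_measure. 0 \<le> \<rho> w) \<longrightarrow>
         (AE w in sphere_measure. 0 \<le> S_star \<rho> w) \<and> L1_norm (S_star \<rho>) = L1_norm \<rho>)" if "\<eta> > 0" for \<eta>
  proof -
    interpret pca \<nu> \<eta> by (rule loc[OF that])
    show ?thesis
      by (intro exI[of _ S_dual] conjI ballI impI S_dual_maps_classes S_dual_duality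
          S_dual_contraction S_dual_positive)
  qed
  show ?thesis by (intro conjI[OF _ conjI] allI impI i ii iii)
qed

end
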